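(* Let $n\ge2$ and let $\mathcal P$ be a compact subset of $(-\infty,-n-1)$. There exists a positive constant $C_n(\mathcal P)$ depending only on $n$ and $\mathcal P$ such that $$\frac1{C_n(\mathcal P)}\le h(x)\le C_n(\mathcal P),\qquad\forall x\in\mathbb S^n,$$ for every $p\in\mathcal P$ and every solution $h\in\mathcal C_{n,p}$.
   Context: $\mathcal C_{n,p}$ is the set of solutions of $\det(\nabla^2h+hI)=h^{p-1}$ on the unit sphere $\mathbb S^n\subset\mathbb R^{n+1}$, where $\nabla^2$ is the Hessian for the round metric in an orthonormal frame, and a solution is a positive smooth function $h$ with $\nabla^2h+hI$ positive definite satisfying the equation (the support function of a convex body containing the origin). *)

theory Defs
  imports "HOL-Analysis.Analysis"
begin

text \<open>Only meaningful for open \<open>S\<close>: the derivatives are taken in the whole space.\<close>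

primrec Ck_on :: "nat \<Rightarrow> 'a::real_normed_vector set \<Rightarrow> ('a \<Rightarrow> real) \<Rightarrow> bool" where
  "Ck_on 0 S f \<longleftrightarrow> continuous_on S f"
| "Ck_on (Suc k) S f \<longleftrightarrow> (\<forall>x\<in>S. f differentiable at x) \<and>
     (\<forall>v. Ck_on k S (\<lambda>x. frechet_derivative f (at x) v))"

definition smooth_on :: "'a::real_normed_vector set \<Rightarrow> ('a \<Rightarrow> real) \<Rightarrow> bool" where
  "smooth_on S f \<longleftrightarrow> (\<forall>k. Ck_on k S f)"

text \<open>A function on the unit sphere is represented by a function on the ambient space, of which only
  the values on the sphere matter. It is differentiated through its extension that is constant on
  rays; since \<open>y \<mapsto> y / |y|\<close> is a smooth retraction of the punctured space onto the sphere, a function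
  is smooth on the sphere iff this extension is smooth away from the origin, and on vectors tangent
  to the sphere the derivative of the extension is the differential of the function.\<close>

definition radial_ext :: "('a::real_normed_vector \<Rightarrow> 'b) \<Rightarrow> 'a \<Rightarrow> 'b" where
  "radial_ext f y = f (y /\<^sub>R norm y)"

definition smooth_on_sphere :: "('a::real_normed_vector \<Rightarrow> real) \<Rightarrow> bool" where
  "smooth_on_sphere f \<longleftrightarrow> smooth_on (- {0}) (radial_ext f)"

definition sphere_deriv ::
    "('a::real_normed_vector \<Rightarrow> 'b::real_normed_vector) \<Rightarrow> 'a \<Rightarrow> 'a \<Rightarrow> 'b" where
  "sphere_deriv f x = frechet_derivative (radial_ext f) (at x)"

text \<open>The radial derivative of the extension vanishes, so this vector is tangent to the sphere.\<close>

definition sphere_grad :: "('a::euclidean_space \<Rightarrow> real) \<Rightarrow> 'a \<Rightarrow> 'a" where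
  "sphere_grad h x = (\<Sum>b\<in>Basis. sphere_deriv h x b *\<^sub>R b)"

text \<open>The Hessian \<open>\<langle>\<nabla>\<^sub>u grad h, v\<rangle>\<close> for tangent vectors \<open>u\<close>, \<open>v\<close> at \<open>x\<close>. The Levi-Civita connection of the
  round metric is the tangential part of the ambient derivative; the inner product with the
  tangent vector \<open>v\<close> discards the normal part.\<close>

definition sphere_hessian :: "('a::euclidean_space \<Rightarrow> real) \<Rightarrow> 'a \<Rightarrow> 'a \<Rightarrow> 'a \<Rightarrow> real" where
  "sphere_hessian h x u v = sphere_deriv (sphere_grad h) x u \<bullet> v"

text \<open>From here on \<open>n = CARD('n)\<close>, and \<open>real ^ ('n option)\<close> is the space of dimension \<open>n + 1\<close>. The \<open>n\<close>
  orthonormal vectors below form a basis of the tangent space at \<open>x\<close>.\<close>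

definition orthonormal_frame_at ::
    "real ^ ('n::finite option) \<Rightarrow> ('n \<Rightarrow> real ^ ('n option)) \<Rightarrow> bool" where
  "orthonormal_frame_at x e \<longleftrightarrow>
     (\<forall>i. e i \<bullet> x = 0) \<and> (\<forall>i j. e i \<bullet> e j = (if i = j then 1 else 0))"

definition hessian_matrix ::
    "(real ^ ('n::finite option) \<Rightarrow> real) \<Rightarrow> real ^ ('n option) \<Rightarrow>
     ('n \<Rightarrow> real ^ ('n option)) \<Rightarrow> real ^ 'n ^ 'n" where
  "hessian_matrix h x e = (\<chi> i j. sphere_hessian h x (e i) (e j))"

definition pos_def_matrix :: "real ^ 'n ^ 'n \<Rightarrow> bool" where
  "pos_def_matrix A \<longleftrightarrow> transpose A = A \<and> (\<forall>\<xi>. \<xi> \<noteq> 0 \<longrightarrow> \<xi> \<bullet> (A *v \<xi>) > 0)"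

definition solutions :: "real \<Rightarrow> (real ^ ('n::finite option) \<Rightarrow> real) set" where
  "solutions p = {h. smooth_on_sphere h \<and>
     (\<forall>x\<in>sphere 0 1. h x > 0) \<and>
     (\<forall>x\<in>sphere 0 1. \<forall>e. orthonormal_frame_at x e \<longrightarrow>
        pos_def_matrix (hessian_matrix h x e + h x *\<^sub>R mat 1) \<and>
        det (hessian_matrix h x e + h x *\<^sub>R mat 1) = h x powr (p - 1))}"

end

theory Submission
  imports Defs
begin

text \<open>
  Let \<open>K\<close> be the convex body with support function \<open>h\<close>, \<open>H\<close> the 1-homogeneous extension of \<open>h\<close>,
  \<open>N = n + 1\<close>, \<open>M = max h = h(e)\<close>, \<open>m = min h\<close>. Integrating \<open>w \<mapsto> 1\<close> and \<open>w \<mapsto> e \<bullet> w\<close> over the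
  translates \<open>K + te\<close>, with the inverse Gauss map as change of variables, and inserting the equation,
  gives \<open>\<integral> (e \<bullet> x) h\<^sup>p\<^sup>-\<^sup>1 = 0\<close> and \<open>\<integral> (e \<bullet> x) (e \<bullet> \<nabla>H) h\<^sup>p\<^sup>-\<^sup>1 = (1/N) \<integral> h\<^sup>p\<close>. Integration by parts in the
  second identity yields, as \<open>p \<noteq> -N\<close>, the isotropy relation \<open>\<integral> (e \<bullet> x)\<^sup>2 h\<^sup>p = (1/N) \<integral> h\<^sup>p\<close>. Since
  \<open>h \<ge> M (e \<bullet> x)\<close>, these relations prevent \<open>h\<^sup>p\<close> from concentrating where \<open>h \<le> \<delta>M\<close>, so \<open>\<integral> (h/M)\<^sup>p\<close> is
  bounded; but \<open>h\<close> is \<open>M\<close>-Lipschitz, so this integral is at least a multiple of \<open>(m/M)\<^sup>p\<^sup>+\<^sup>N\<close>, and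
  \<open>p + N < 0\<close> bounds \<open>M/m\<close>. Finally \<open>m \<le> 1 \<le> M\<close>, because \<open>vol K = (1/N) \<integral> h\<^sup>p\<close>.

  All integrals are taken over the punctured unit ball, with \<open>h(y/|y|)\<close> in place of \<open>h\<close>, instead of
  over the sphere; this changes them by the factor \<open>1/N\<close> only.
\<close>

section \<open>Determinants and index types\<close>

text \<open>Why p = -N is the barrier: there the equation is invariant under volume-preserving
  linear maps, and all origin-centred ellipsoids with the volume of the unit ball solve it, however
  eccentric. In the isotropy relation this appears as a factor N + p on both sides. Compactness of
  the parameter set is used at its two ends: its maximum keeps p + N away from 0, its minimum bounds
  the constant (12 N)^(-p). Translates are the right comparison bodies because K + v has support
  function h + v \<bullet> x but the same Hessian matrix; the density stays h^(p-1) with the h of K,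
  although K + v does not solve the equation. Integrals over translates thus give identities linear
  in one fixed density. Working in the ball turns surface integrals into Lebesgue integrals, and
  integration by parts into translation invariance of the measure for a Lipschitz function. The
  price is the radial weights |y| and 1 - |y|, which can be exchanged for 0-homogeneous
  integrands.\<close>

lemma det_reindex:
  fixes A :: "real^'b^'b" and \<pi> :: "'a::finite \<Rightarrow> 'b::finite"
  assumes "bij \<pi>"
  shows "det (\<chi> i j. A $ \<pi> i $ \<pi> j) = det A"
proof -
  have inj: "inj \<pi>" and sur: "surj \<pi>" using assms by (auto simp: bij_def)
  let ?m = "map_permutation UNIV \<pi>"
  have app: "?m p (\<pi> x) = \<pi> (p x)" for p x
    using inj by (intro map_permutation_apply) auto
  have b: "bij_betw ?m {p. p permutes UNIV} {q. q permutes UNIV}"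
  proof (rule bij_betw_imageI)
    show "inj_on ?m {p. p permutes UNIV}"
      by (rule inj_onI, rule ext) (metis app inj injD)
    show "?m ` {p. p permutes UNIV} = {q. q permutes UNIV}"
    proof
      show "?m ` {p. p permutes UNIV} \<subseteq> {q. q permutes UNIV}"
        using assms by (auto intro!: map_permutation_permutes[where A=UNIV and B=UNIV])
      show "{q. q permutes UNIV} \<subseteq> ?m ` {p. p permutes UNIV}"
      proof safe
        fix q :: "'b \<Rightarrow> 'b" assume q: "q permutes UNIV"
        let ?p = "inv \<pi> \<circ> q \<circ> \<pi>"
        have "bij ?p" using assms q by (simp add: bij_comp bij_imp_bij_inv permutes_bij)
        then have "?p permutes UNIV" by (rule bij_imp_permutes) simp
        then have "?m ?p \<in> ?m ` {p. p permutes UNIV}" by (intro imageI CollectI)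
        moreover have "?m ?p = q"
        proof
          fix y
          obtain x where "y = \<pi> x" using sur by (meson surjD)
          then show "?m ?p y = q y" using sur by (simp add: app surj_f_inv_f)
        qed
        ultimately show "q \<in> ?m ` {p. p permutes UNIV}" by (simp only:)
      qed
    qed
  qed
  have "det A = (\<Sum>p | p permutes (UNIV::'a set). of_int (sign (?m p)) * (\<Prod>i\<in>UNIV. A $ i $ ?m p i))"
    unfolding det_def by (rule sum.reindex_bij_betw[OF b, symmetric])
  also have "\<dots> = (\<Sum>p | p permutes (UNIV::'a set). of_int (sign p) * (\<Prod>i\<in>UNIV. A $ \<pi> i $ \<pi> (p i)))"
  proof (rule sum.cong[OF refl])
    fix p assume "p \<in> {p. p permutes (UNIV::'a set)}"
    then have "sign (?m p) = sign p" using inj by (intro sign_map_permutation) auto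
    moreover have "(\<Prod>i\<in>UNIV. A $ i $ ?m p i) = (\<Prod>i\<in>UNIV. A $ \<pi> i $ ?m p (\<pi> i))"
      by (rule prod.reindex_bij_betw[symmetric]) (use assms in auto)
    ultimately show "of_int (sign (?m p)) * (\<Prod>i\<in>UNIV. A $ i $ ?m p i) =
       of_int (sign p) * (\<Prod>i\<in>UNIV. A $ \<pi> i $ \<pi> (p i))" by (simp add: app)
  qed
  finally show ?thesis by (simp add: det_def)
qed

text \<open>A permutation moving \<open>None\<close> picks an entry \<open>A $ None $ Some j\<close>
  and contributes 0; the others are the permutations of \<open>range Some\<close>. With
  \<open>None\<close> as radial direction this reduces the Jacobian in dimension n + 1 to the n by n
  determinant of the equation.\<close>

lemma det_option_block:
  fixes A :: "real^('n::finite option)^('n option)"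
  assumes "\<And>j. A $ None $ Some j = 0"
  shows "det A = A $ None $ None * det (\<chi> i j. A $ Some i $ Some j)"
proof -
  let ?R = "range (Some :: 'n \<Rightarrow> 'n option)"
  let ?m = "map_permutation UNIV (Some :: 'n \<Rightarrow> 'n option)"
  have app: "?m p (Some x) = Some (p x)" for p x
    by (intro map_permutation_apply) auto
  have mN: "?m p None = None" for p
    unfolding map_permutation_def by simp
  have bs: "bij_betw Some UNIV ?R" by (simp add: bij_betw_def)
  have b: "bij_betw ?m {p. p permutes UNIV} {q. q permutes ?R}"
  proof (rule bij_betw_imageI)
    show "inj_on ?m {p. p permutes UNIV}"
      by (rule inj_onI, rule ext) (metis app option.inject)
    show "?m ` {p. p permutes UNIV} = {q. q permutes ?R}"
    proof
      show "?m ` {p. p permutes UNIV} \<subseteq> {q. q permutes ?R}"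
        using bs by (auto intro!: map_permutation_permutes)
      show "{q. q permutes ?R} \<subseteq> ?m ` {p. p permutes UNIV}"
      proof safe
        fix q assume q: "q permutes ?R"
        \<comment> \<open>\<open>q\<close> maps \<open>range Some\<close> to itself, so
          \<open>the\<close> never meets \<open>None\<close>.\<close>
        let ?p = "the \<circ> q \<circ> Some"
        have qs: "Some (the (q (Some x))) = q (Some x)" for x
          using permutes_in_image[OF q, of "Some x"] by auto
        have "inj ?p"
          using permutes_inj[OF q] qs by (auto simp: inj_def) (metis option.inject)
        then have "bij ?p" by (intro bijI finite_UNIV_inj_surj[OF finite])
        then have "?p permutes UNIV" by (rule bij_imp_permutes) simp
        then have "?m ?p \<in> ?m ` {p. p permutes UNIV}" by (intro imageI CollectI)
        moreover have "?m ?p = q"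
        proof
          fix y show "?m ?p y = q y"
            by (cases y) (auto simp: app mN qs permutes_not_in[OF q])
        qed
        ultimately show "q \<in> ?m ` {p. p permutes UNIV}" by (simp only:)
      qed
    qed
  qed
  let ?t = "\<lambda>q. of_int (sign q) * (\<Prod>i\<in>UNIV. A $ i $ q i) :: real"
  have U: "UNIV = insert None ?R" by (simp add: UNIV_option_conv)
  have "det A = sum ?t {q. q permutes UNIV}" by (simp add: det_def)
  also have "\<dots> = sum ?t {q. q permutes ?R}"
  proof (rule sum.mono_neutral_right)
    show "{q. q permutes ?R} \<subseteq> {q. q permutes UNIV}" by (auto intro: permutes_subset)
    show "\<forall>q\<in>{q. q permutes UNIV} - {q. q permutes ?R}. ?t q = 0"
    proof
      fix q assume q: "q \<in> {q. q permutes UNIV} - {q. q permutes ?R}"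
      have "q None \<noteq> None"
      proof
        assume "q None = None"
        then have "\<forall>x\<in>UNIV - ?R. q x = x" by (metis DiffD2 not_None_eq rangeI)
        then have "q permutes ?R" using q permutes_superset[of q UNIV ?R] by blast
        then show False using q by simp
      qed
      then obtain j where "q None = Some j" by auto
      then have "A $ None $ q None = 0" using assms by simp
      then have "(\<Prod>i\<in>UNIV. A $ i $ q i) = 0" by (intro prod_zero) auto
      then show "?t q = 0" by simp
    qed
  qed simp
  also have "\<dots> = (\<Sum>p | p permutes (UNIV::'n set). ?t (?m p))"
    by (rule sum.reindex_bij_betw[OF b, symmetric])
  also have "\<dots> = (\<Sum>p | p permutes (UNIV::'n set). A $ None $ None *
      (of_int (sign p) * (\<Prod>i\<in>UNIV. A $ Some i $ Some (p i))))"
  proof (rule sum.cong[OF refl])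
    fix p assume "p \<in> {p. p permutes (UNIV::'n set)}"
    then have "sign (?m p) = sign p" by (intro sign_map_permutation) auto
    moreover have "(\<Prod>i\<in>UNIV. A $ i $ ?m p i) = A $ None $ None * (\<Prod>i\<in>?R. A $ i $ ?m p i)"
      by (subst U, subst prod.insert) (auto simp: mN)
    moreover have "(\<Prod>i\<in>?R. A $ i $ ?m p i) = (\<Prod>i\<in>UNIV. A $ Some i $ Some (p i))"
      by (subst prod.reindex) (auto simp: app)
    ultimately show "?t (?m p) = A $ None $ None * (of_int (sign p) * (\<Prod>i\<in>UNIV. A $ Some i $ Some (p i)))"
      by simp
  qed
  also have "\<dots> = A $ None $ None * det (\<chi> i j. A $ Some i $ Some j)"
    by (simp add: det_def sum_distrib_left)
  finally show ?thesis .
qed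

text \<open>The change-of-variables theorems of the library need an index type of class \<open>wellorder\<close>; this type
  provides one of the same cardinality for every finite index type.\<close>

typedef (overloaded) 'a idx = "{..<CARD('a::finite)}"
  by (rule exI[of _ 0]) (simp add: card_gt_0_iff)

instantiation idx :: (finite) "{finite, wellorder}"
begin
definition "less_eq_idx (x::'a idx) (y::'a idx) \<longleftrightarrow> Rep_idx x \<le> Rep_idx y"
definition "less_idx (x::'a idx) (y::'a idx) \<longleftrightarrow> Rep_idx x < Rep_idx y"
instance
proof
  have "(UNIV :: 'a idx set) = Abs_idx ` {..<CARD('a)}"
    using type_definition.Abs_image[OF type_definition_idx[where 'a='a]] by simp
  then show "finite (UNIV :: 'a idx set)" by (metis finite_imageI finite_lessThan)
  show "P a" if "\<And>x::'a idx. (\<And>y. y < x \<Longrightarrow> P y) \<Longrightarrow> P x" for P a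
    by (induction a rule: measure_induct_rule[of Rep_idx]) (use that in \<open>auto simp: less_idx_def\<close>)
qed (auto simp: less_eq_idx_def less_idx_def Rep_idx_inject)
end

lemma ex_bij_idx: "\<exists>\<pi> :: 'a::finite idx \<Rightarrow> 'a. bij \<pi>"
proof -
  have "card (UNIV :: 'a idx set) = CARD('a)"
    using type_definition.card[OF type_definition_idx[where 'a='a]] by simp
  then show ?thesis by (metis finite_same_card_bij finite)
qed

section \<open>Change of variables\<close>

lemma set_integrable_lebesgue:
  fixes f :: "'a::euclidean_space \<Rightarrow> real"
  assumes "set_integrable lborel S f"
  shows "set_integrable lebesgue S f"
proof -
  have "(\<lambda>x. indicator S x *\<^sub>R f x) \<in> borel_measurable lborel"
    using assms unfolding set_integrable_def by (rule borel_measurable_integrable)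
  from integrable_completion[OF this] assms show ?thesis unfolding set_integrable_def by blast
qed

text \<open>The substitution theorem behind this is about Lebesgue measurable sets and gauge
  integrals; integrability is moved to the completion of \<open>lborel\<close> and back.\<close>

lemma change_of_variables_wellorder:
  fixes g :: "real^'m::{finite,wellorder} \<Rightarrow> real^'m::_" and f :: "real^'m::_ \<Rightarrow> real"
  assumes S: "S \<in> sets borel" and gS: "g ` S \<in> sets borel"
    and der: "\<And>x. x \<in> S \<Longrightarrow> (g has_derivative g' x) (at x)"
    and inj: "inj_on g S"
    and f: "f \<in> borel_measurable borel"
    and int: "set_integrable lborel S (\<lambda>x. \<bar>det (matrix (g' x))\<bar> * f (g x))"
  shows "set_integrable lborel (g ` S) f"
    and "(LINT y:g ` S|lborel. f y) = (LINT x:S|lborel. \<bar>det (matrix (g' x))\<bar> * f (g x))"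
proof -
  \<comment> \<open>The substitution theorem is for vector-valued integrands: the scalar travels
    along the unit vector \<open>v\<close> and is recovered by the inner product with
    \<open>v\<close>.\<close>
  define v :: "real^'m::_" where "v = axis undefined 1"
  have vv: "v \<bullet> v = 1" by (simp add: v_def inner_axis_axis)
  let ?J = "\<lambda>x. \<bar>det (matrix (g' x))\<bar> * f (g x)"
  have i1: "?J absolutely_integrable_on S" by (rule set_integrable_lebesgue[OF int])
  have i2: "(\<lambda>x. ?J x *\<^sub>R v) absolutely_integrable_on S"
    using absolutely_integrable_scaleR_right[OF i1, of v] i1
    by (simp add: set_integrable_def flip: scaleR_scaleR)
  have i3: "integral S (\<lambda>x. ?J x *\<^sub>R v) = integral S ?J *\<^sub>R v"
    using has_integral_scaleR_left[OF integrable_integral[OF set_lebesgue_integral_eq_integral(1)[OF i1]], of v]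
    by (rule integral_unique)
  have "(\<lambda>x. \<bar>det (matrix (g' x))\<bar> *\<^sub>R (f (g x) *\<^sub>R v)) absolutely_integrable_on S \<and>
      integral S (\<lambda>x. \<bar>det (matrix (g' x))\<bar> *\<^sub>R (f (g x) *\<^sub>R v)) = integral S ?J *\<^sub>R v"
    using i2 i3 by simp
  moreover have "S \<in> sets lebesgue" using S by simp
  ultimately have c: "(\<lambda>y. f y *\<^sub>R v) absolutely_integrable_on (g ` S)"
     "integral (g ` S) (\<lambda>y. f y *\<^sub>R v) = integral S ?J *\<^sub>R v"
    using has_absolute_integral_change_of_variables[of S g g' "\<lambda>y. f y *\<^sub>R v"] der inj
    by (auto intro: has_derivative_at_withinI)
  have "(\<lambda>y. (f y *\<^sub>R v) \<bullet> v) absolutely_integrable_on (g ` S)"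
    using absolutely_integrable_component[OF c(1), of v] .
  then have a: "f absolutely_integrable_on (g ` S)" by (simp add: vv)
  then show b: "set_integrable lborel (g ` S) f"
    unfolding set_integrable_def using f gS by (subst (asm) integrable_completion) auto
  have "integral (g ` S) (\<lambda>y. f y *\<^sub>R v) = integral (g ` S) f *\<^sub>R v"
    using has_integral_scaleR_left[OF integrable_integral[OF set_lebesgue_integral_eq_integral(1)[OF a]], of v]
    by (rule integral_unique)
  then have "integral (g ` S) f *\<^sub>R v \<bullet> v = integral S ?J *\<^sub>R v \<bullet> v"
    using c(2) by (simp only:)
  then have "integral (g ` S) f = integral S ?J" by (simp only: inner_scaleR_left vv)
  then show "(LINT y:g ` S|lborel. f y) = (LINT x:S|lborel. ?J x)"
    using set_borel_integral_eq_integral(2)[OF b] set_borel_integral_eq_integral(2)[OF int] by simp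
qed

section \<open>Permutation of coordinates\<close>

definition reindex :: "('b \<Rightarrow> 'a) \<Rightarrow> real^'a \<Rightarrow> real^'b" where
  "reindex \<pi> x = (\<chi> i. x $ \<pi> i)"

lemma linear_reindex: "linear (reindex \<pi>)"
  by (rule linearI) (auto simp: reindex_def vec_eq_iff)

lemma borel_measurable_reindex [measurable]: "reindex (\<pi> :: 'b::finite \<Rightarrow> 'a::finite) \<in> borel_measurable borel"
  by (intro borel_measurable_continuous_onI linear_continuous_on)
     (simp add: linear_conv_bounded_linear[symmetric] linear_reindex)

lemma reindex_inv:
  assumes "bij \<pi>"
  shows "reindex \<pi> (reindex (inv \<pi>) x) = x" and "reindex (inv \<pi>) (reindex \<pi> y) = y"
  using assms by (auto simp: reindex_def vec_eq_iff bij_is_inj bij_is_surj surj_f_inv_f inv_f_f)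

text \<open>A box goes to the box with permuted sides, and \<open>lborel\<close> is determined by
  its values on boxes.\<close>

lemma distr_lborel_reindex:
  fixes \<pi> :: "'b::finite \<Rightarrow> 'a::finite"
  assumes "bij \<pi>"
  shows "distr lborel borel (reindex \<pi>) = lborel"
proof (rule sym, rule lborel_eqI)
  fix l u :: "real^'b" assume le: "\<And>b. b \<in> Basis \<Longrightarrow> l \<bullet> b \<le> u \<bullet> b"
  have le': "l $ i \<le> u $ i" for i using le[of "axis i 1"] by (simp add: cart_eq_inner_axis)
  have \<pi>: "\<pi> (inv \<pi> i) = i" "inv \<pi> (\<pi> j) = j" for i j
    using assms by (auto simp: bij_is_inj bij_is_surj surj_f_inv_f inv_f_f)
  have "reindex \<pi> -` box l u = box (reindex (inv \<pi>) l) (reindex (inv \<pi>) u)"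
    by (auto simp: mem_box_cart reindex_def \<pi>) (metis \<pi>)+
  then have "emeasure (distr lborel borel (reindex \<pi>)) (box l u) =
      emeasure lborel (box (reindex (inv \<pi>) l) (reindex (inv \<pi>) u))"
    by (simp add: emeasure_distr)
  also have "\<dots> = (\<Prod>b\<in>Basis. (reindex (inv \<pi>) u - reindex (inv \<pi>) l) \<bullet> b)"
    by (rule emeasure_lborel_box) (auto simp: Basis_vec_def inner_axis reindex_def le')
  also have "(\<Prod>b\<in>Basis. (reindex (inv \<pi>) u - reindex (inv \<pi>) l) \<bullet> b) =
      (\<Prod>i\<in>UNIV. (reindex (inv \<pi>) u - reindex (inv \<pi>) l) $ i)"
    by (simp add: Basis_vec_def UNION_singleton_eq_range, subst prod.reindex)
       (auto simp: inj_def axis_eq_axis inner_axis)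
  also have "\<dots> = (\<Prod>i\<in>UNIV. (u - l) $ inv \<pi> i)" by (simp add: reindex_def)
  also have "\<dots> = (\<Prod>i\<in>UNIV. (u - l) $ i)"
    by (rule prod.reindex_bij_betw) (use assms bij_imp_bij_inv in auto)
  also have "\<dots> = (\<Prod>b\<in>Basis. (u - l) \<bullet> b)"
    by (simp add: Basis_vec_def UNION_singleton_eq_range, subst prod.reindex)
       (auto simp: inj_def axis_eq_axis inner_axis)
  finally show "emeasure (distr lborel borel (reindex \<pi>)) (box l u) = (\<Prod>b\<in>Basis. (u - l) \<bullet> b)" .
qed simp

lemma set_integral_reindex:
  fixes \<pi> :: "'b::finite \<Rightarrow> 'a::finite" and f :: "real^'b \<Rightarrow> real"
  assumes "bij \<pi>" and "(\<lambda>x. indicator S x * f x) \<in> borel_measurable borel"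
  shows "set_integrable lborel S f \<longleftrightarrow> set_integrable lborel (reindex (inv \<pi>) ` S) (\<lambda>x. f (reindex \<pi> x))"
    and "(LINT x:S|lborel. f x) = (LINT x:reindex (inv \<pi>) ` S|lborel. f (reindex \<pi> x))"
proof -
  have ind: "indicator S (reindex \<pi> x) = (indicator (reindex (inv \<pi>) ` S) x :: real)" for x
    using assms(1) reindex_inv[OF assms(1)] by (auto simp: indicator_def image_iff)
  show "set_integrable lborel S f \<longleftrightarrow> set_integrable lborel (reindex (inv \<pi>) ` S) (\<lambda>x. f (reindex \<pi> x))"
    unfolding set_integrable_def
    by (subst distr_lborel_reindex[OF assms(1), symmetric], subst integrable_distr_eq)
       (use assms(2) in \<open>auto simp: ind\<close>)
  show "(LINT x:S|lborel. f x) = (LINT x:reindex (inv \<pi>) ` S|lborel. f (reindex \<pi> x))"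
    unfolding set_lebesgue_integral_def
    by (subst distr_lborel_reindex[OF assms(1), symmetric], subst integral_distr)
       (use assms(2) in \<open>auto simp: ind\<close>)
qed

text \<open>Conjugating \<open>g\<close> with the coordinate permutation to \<open>'m idx\<close>
  changes neither volumes nor, by \<open>det_reindex\<close>, the Jacobian, so the well-ordered case
  applies.\<close>

lemma change_of_variables:
  fixes g :: "real^'m::finite \<Rightarrow> real^'m" and f :: "real^'m \<Rightarrow> real"
  assumes S: "S \<in> sets borel" and gS: "g ` S \<in> sets borel"
    and der: "\<And>x. x \<in> S \<Longrightarrow> (g has_derivative g' x) (at x)"
    and inj: "inj_on g S"
    and f: "f \<in> borel_measurable borel"
    and int: "set_integrable lborel S (\<lambda>x. \<bar>det (matrix (g' x))\<bar> * f (g x))"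
  shows "set_integrable lborel (g ` S) f"
    and "(LINT y:g ` S|lborel. f y) = (LINT x:S|lborel. \<bar>det (matrix (g' x))\<bar> * f (g x))"
proof -
  obtain \<pi> :: "'m idx \<Rightarrow> 'm" where \<pi>: "bij \<pi>" using ex_bij_idx by blast
  have \<pi>': "bij (inv \<pi>)" "inv (inv \<pi>) = \<pi>" using \<pi> by (auto simp: bij_imp_bij_inv inv_inv_eq)
  let ?R = "reindex \<pi> :: real^'m \<Rightarrow> real^'m idx"
  let ?Q = "reindex (inv \<pi>) :: real^'m idx \<Rightarrow> real^'m"
  have RQ [simp]: "?R (?Q y) = y" and QR [simp]: "?Q (?R x) = x" for x y
    using reindex_inv[OF \<pi>] by auto
  let ?g = "?R \<circ> g \<circ> ?Q" and ?g' = "\<lambda>x. ?R \<circ> g' (?Q x) \<circ> ?Q"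
  have im: "?R ` A = ?Q -` A" for A by (auto simp: image_iff) (metis RQ)
  have bl: "bounded_linear ?R" "bounded_linear ?Q"
    by (simp_all add: linear_conv_bounded_linear[symmetric] linear_reindex)
  have det: "det (matrix (?g' y)) = det (matrix (g' (?Q y)))" if "?Q y \<in> S" for y
  proof -
    have ax: "?Q (axis j 1) = axis (\<pi> j) 1" for j
      using \<pi> by (auto simp: reindex_def vec_eq_iff axis_def bij_is_inj bij_is_surj surj_f_inv_f inv_f_f)
    have "matrix (?g' y) = (\<chi> i j. matrix (g' (?Q y)) $ \<pi> i $ \<pi> j)"
      by (simp add: matrix_def vec_eq_iff ax) (simp add: reindex_def)
    then show ?thesis by (simp add: det_reindex[OF \<pi>])
  qed
  have det': "det (matrix (?R \<circ> g' x \<circ> ?Q)) = det (matrix (g' x))" if "x \<in> S" for x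
    using det[of "?R x"] that by simp
  let ?J = "\<lambda>x. \<bar>det (matrix (g' x))\<bar> * f (g x)"
  let ?J' = "\<lambda>y. \<bar>det (matrix (?g' y))\<bar> * f (?Q (?g y))"
  have mJ: "(\<lambda>x. indicator S x * ?J x) \<in> borel_measurable borel"
    using borel_measurable_integrable[OF int[unfolded set_integrable_def]] by simp
  have JJ: "set_integrable lborel (?R ` S) ?J' \<longleftrightarrow> set_integrable lborel (?R ` S) (\<lambda>y. ?J (?Q y))"
    unfolding set_integrable_def
    by (rule arg_cong[of _ _ "integrable lborel"], rule ext) (auto simp: indicator_def det')
  have int': "set_integrable lborel (?R ` S) ?J'"
    unfolding JJ using set_integral_reindex(1)[OF \<pi>'(1) mJ] int by (simp add: \<pi>'(2))
  have LJ: "(LINT y:?R ` S|lborel. ?J' y) = (LINT x:S|lborel. ?J x)"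
    using set_integral_reindex(2)[OF \<pi>'(1) mJ] unfolding set_lebesgue_integral_def \<pi>'(2)
    by (auto intro!: Bochner_Integration.integral_cong simp: indicator_def det')
  have gim: "?g ` (?R ` S) = ?R ` (g ` S)" by (auto simp: image_image)
  have im_borel: "?R ` A \<in> sets borel" if "A \<in> sets borel" for A
    unfolding im by (rule measurable_sets_borel[OF borel_measurable_reindex that])
  have S': "?R ` S \<in> sets borel" and gS': "?g ` (?R ` S) \<in> sets borel"
    unfolding gim using S gS im_borel by blast+
  have der': "(?g has_derivative ?g' y) (at y)" if "y \<in> ?R ` S" for y
  proof -
    have "?Q y \<in> S" using that by auto
    then have 1: "(g has_derivative g' (?Q y)) (at (?Q y))" by (rule der)
    have 2: "(?Q has_derivative ?Q) (at y)" by (rule bounded_linear_imp_has_derivative[OF bl(2)])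
    have 3: "(?R has_derivative ?R) (at (g (?Q y)))"
      by (rule bounded_linear_imp_has_derivative[OF bl(1)])
    show ?thesis using diff_chain_at[OF diff_chain_at[OF 2 1] ] 3 by (simp add: o_assoc)
  qed
  have inj': "inj_on ?g (?R ` S)"
    using inj by (auto simp: inj_on_def) (metis QR)
  have f': "(\<lambda>y. f (?Q y)) \<in> borel_measurable borel" using f by measurable
  note c = change_of_variables_wellorder[OF S' gS' der' inj' f' int', unfolded gim]
  have mf: "(\<lambda>x. indicator (g ` S) x * f x) \<in> borel_measurable borel" using f gS by measurable
  show "set_integrable lborel (g ` S) f"
    using c(1) set_integral_reindex(1)[OF \<pi>'(1) mf] by (simp add: \<pi>'(2) gim)
  show "(LINT y:g ` S|lborel. f y) = (LINT x:S|lborel. ?J x)"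
    using c(2) set_integral_reindex(2)[OF \<pi>'(1) mf] LJ unfolding \<pi>'(2) by (simp only:)
qed

section \<open>Integrals of homogeneous functions and of directional derivatives\<close>

lemma integral_lborel_scaleR:
  fixes F :: "'a::euclidean_space \<Rightarrow> real"
  assumes "c > 0" and [measurable]: "F \<in> borel_measurable borel"
  shows "(\<integral>y. F (c *\<^sub>R y) \<partial>lborel) = (\<integral>y. F y \<partial>lborel) / c ^ DIM('a)"
proof -
  have [measurable]: "(\<lambda>x. 0 + c *\<^sub>R x) \<in> borel_measurable (borel :: 'a measure)" by measurable
  have "(\<integral>y. F y \<partial>lborel) = (\<integral>y. F y \<partial>density (distr lborel borel (\<lambda>x. 0 + c *\<^sub>R x)) (\<lambda>_. ennreal (c ^ DIM('a))))"
    using lborel_affine[of c "0::'a"] assms(1) by (simp add: ennreal_power)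
  also have "\<dots> = (\<integral>y. c ^ DIM('a) * F (c *\<^sub>R y) \<partial>lborel)"
    using assms(1) by (subst integral_density) (auto simp: integral_distr)
  finally show ?thesis using assms(1) by simp
qed

lemma integral_lborel_translate:
  fixes F :: "'a::euclidean_space \<Rightarrow> real"
  assumes [measurable]: "F \<in> borel_measurable borel"
  shows "(\<integral>y. F (y + v) \<partial>lborel) = (\<integral>y. F y \<partial>lborel)"
proof -
  have "(\<integral>y. F y \<partial>lborel) = (\<integral>y. F y \<partial>distr lborel borel ((+) v))" by (simp add: lborel_distr_plus)
  also have "\<dots> = (\<integral>y. F (v + y) \<partial>lborel)" by (subst integral_distr) auto
  finally show ?thesis by (simp add: add.commute)
qed

lemma integrable_lborel_cball:
  fixes F :: "'a::euclidean_space \<Rightarrow> real"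
  assumes "F \<in> borel_measurable borel" and "\<And>y. y \<in> cball a r \<Longrightarrow> \<bar>F y\<bar> \<le> C" and "\<And>y. y \<notin> cball a r \<Longrightarrow> F y = 0"
  shows "integrable lborel F"
  by (rule integrableI_bounded_set[where A="cball a r" and B=C])
     (use assms emeasure_lborel_cball_finite[of a r] in auto)

lemma set_integrable_lborel_bounded:
  fixes F :: "'a::euclidean_space \<Rightarrow> real"
  assumes "S \<in> sets borel" "bounded S" "F \<in> borel_measurable borel" and "\<And>y. y \<in> S \<Longrightarrow> \<bar>F y\<bar> \<le> C"
  shows "set_integrable lborel S F"
proof -
  obtain a r where S: "S \<subseteq> cball a r" using assms(2) bounded_subset_cball by metis
  have "\<bar>indicator S y * F y\<bar> \<le> \<bar>C\<bar>" for y
    using assms(4)[of y] by (auto simp: indicator_def)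
  then show ?thesis unfolding set_integrable_def
    by (intro integrable_lborel_cball[where C="\<bar>C\<bar>" and a=a and r=r])
       (use assms S in \<open>auto simp: indicator_def\<close>)
qed

text \<open>The left-hand side is minus the derivative at \<open>\<lambda> = 1\<close> of
  \<open>\<integral> max 0 (1 - \<lambda>|y|) q(y) dy = \<lambda>\<^sup>-\<^sup>N \<integral> max 0 (1 - |y|) q(y) dy\<close>.\<close>

lemma integral_norm_mult_homogeneous:
  fixes q :: "'a::euclidean_space \<Rightarrow> real"
  assumes q[measurable]: "q \<in> borel_measurable borel"
    and bd: "\<And>y. \<bar>q y\<bar> \<le> C" and hom: "\<And>c y. c > 0 \<Longrightarrow> q (c *\<^sub>R y) = q y"
  shows "(LINT y:ball 0 1|lborel. norm y * q y) = DIM('a) * (\<integral>y. max 0 (1 - norm y) * q y \<partial>lborel)"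
proof -
  have C: "0 \<le> C" using bd[of 0] by linarith
  have [measurable]: "ball (0::'a) 1 \<in> sets borel" by simp
  define L where "L c = (\<integral>y. max 0 (1 - c * norm y) * q y \<partial>lborel)" for c
  \<comment> \<open>\<open>c k\<close> tends to 1 from above, so all supports stay in the unit ball
    and a single bound dominates the difference quotients.\<close>
  define c where "c k = 1 + inverse (real (Suc k))" for k
  have c1: "c k > 1" "c k > 0" for k by (simp_all add: c_def add_pos_pos)
  have ct: "c \<longlonglongrightarrow> 1" unfolding c_def
    using tendsto_add[OF tendsto_const LIMSEQ_inverse_real_of_nat, of 1] by simp
  have int: "integrable lborel (\<lambda>y. max 0 (1 - a * norm y) * q y)" if "a \<ge> 1" for a
  proof (rule integrable_lborel_cball[where a=0 and r=1 and C=C])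
    show "\<bar>max 0 (1 - a * norm y) * q y\<bar> \<le> C" for y
    proof -
      have "\<bar>max 0 (1 - a * norm y)\<bar> \<le> 1" using that by (auto simp: max_def)
      from mult_mono[OF this bd[of y]] show ?thesis by (simp add: abs_mult)
    qed
    show "max 0 (1 - a * norm y) * q y = 0" if "y \<notin> cball 0 1" for y
    proof -
      have "1 * 1 \<le> a * norm y" using that \<open>a \<ge> 1\<close> by (intro mult_mono) auto
      then show ?thesis by simp
    qed
  qed simp
  have scale: "L (c k) = L 1 / c k ^ DIM('a)" for k
  proof -
    have "L (c k) = (\<integral>y. max 0 (1 - norm (c k *\<^sub>R y)) * q (c k *\<^sub>R y) \<partial>lborel)"
      unfolding L_def using c1[of k] by (auto simp: hom)
    also have "\<dots> = L 1 / c k ^ DIM('a)"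
      unfolding L_def
        by (subst integral_lborel_scaleR[where F="\<lambda>y. max 0 (1 - norm y) * q y"]) (use c1 in auto)
    finally show ?thesis .
  qed
  let ?s = "\<lambda>k y. (max 0 (1 - c k * norm y) - max 0 (1 - norm y)) / (c k - 1) * q y"
  have quot: "(\<integral>y. ?s k y \<partial>lborel) = (L (c k) - L 1) / (c k - 1)" for k
  proof -
    have "(\<integral>y. ?s k y \<partial>lborel) = (\<integral>y. (max 0 (1 - c k * norm y) * q y - max 0 (1 - 1 * norm y) * q y) / (c k - 1) \<partial>lborel)"
      by (rule Bochner_Integration.integral_cong) (auto simp: field_simps)
    also have "\<dots> = (L (c k) - L 1) / (c k - 1)"
      unfolding L_def using int[of "c k"] int[of 1] c1[of k] by simp
    finally show ?thesis .
  qed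
  have lim1: "(\<lambda>k. \<integral>y. ?s k y \<partial>lborel) \<longlonglongrightarrow> (\<integral>y. - (indicator (ball 0 1) y * (norm y * q y)) \<partial>lborel)"
  proof (rule integral_dominated_convergence[where w="\<lambda>y. C * indicator (cball 0 1) y"])
    show "integrable lborel (\<lambda>y::'a. C * indicator (cball 0 1) y)"
      by (rule integrable_lborel_cball[where a=0 and r=1 and C=C])
        (use C in \<open>auto intro!: borel_measurable_times borel_measurable_indicator\<close>)
    show "AE y in lborel. (\<lambda>k. ?s k y) \<longlonglongrightarrow> - (indicator (ball 0 1) y * (norm y * q y))"
    proof (rule AE_I2)
      fix y :: 'a
      show "(\<lambda>k. ?s k y) \<longlonglongrightarrow> - (indicator (ball 0 1) y * (norm y * q y))"
      proof (cases "norm y < 1")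
        case True
        have "(\<lambda>k. c k * norm y) \<longlonglongrightarrow> 1 * norm y" by (intro tendsto_intros ct)
        then have "\<forall>\<^sub>F k in sequentially. c k * norm y < 1"
          using True by (intro order_tendstoD) auto
        then have "\<forall>\<^sub>F k in sequentially. ?s k y = - (norm y * q y)"
        proof eventually_elim
          case (elim k)
          have "(1 - c k * norm y) - (1 - norm y) = - norm y * (c k - 1)"
            by (simp add: algebra_simps)
          then show ?case using elim True c1[of k] by (simp add: max_def)
        qed
        then show ?thesis using True by (simp add: tendsto_eventually)
      next
        case False
        have s0: "?s k y = 0" for k
        proof -
          have "1 * 1 \<le> c k * norm y" using False c1[of k] by (intro mult_mono) auto
          then show ?thesis using False by simp
        qed
        show ?thesis unfolding s0 using False by simp
      qed
    qed
    show "AE y in lborel. norm (?s k y) \<le> C * indicator (cball 0 1) y" for k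
    proof (rule AE_I2)
      fix y :: 'a
      have n: "0 \<le> norm y * (c k - 1)" using c1[of k] by simp
      have "norm y \<le> c k * norm y" using n by (simp add: algebra_simps)
      then have a: "\<bar>max 0 (1 - c k * norm y) - max 0 (1 - norm y)\<bar> \<le> indicator (cball 0 1) y * (norm y * (c k - 1))"
        using n by (auto simp: max_def indicator_def algebra_simps)
      also have "\<dots> \<le> indicator (cball 0 1) y * (c k - 1)"
        using c1[of k] by (auto simp: indicator_def mult_left_le_one_le)
      finally have "\<bar>(max 0 (1 - c k * norm y) - max 0 (1 - norm y)) / (c k - 1)\<bar> \<le> indicator (cball 0 1) y"
        using c1[of k] by (simp add: divide_simps)
      then show "norm (?s k y) \<le> C * indicator (cball 0 1) y"
        using mult_mono[OF _ bd[of y], of _ "indicator (cball 0 1) y"]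
        by (simp only: real_norm_def abs_mult mult.commute[of C] abs_ge_zero indicator_pos_le)
    qed
  qed measurable
  have lim2: "(\<lambda>k. (L (c k) - L 1) / (c k - 1)) \<longlonglongrightarrow> - (DIM('a) * L 1)"
  proof -
    have "((\<lambda>a. L 1 / a ^ DIM('a)) has_real_derivative - (DIM('a) * L 1)) (at 1)"
      by (auto intro!: derivative_eq_intros)
    then have "((\<lambda>a. (L 1 / a ^ DIM('a) - L 1) / (a - 1)) \<longlongrightarrow> - (DIM('a) * L 1)) (at 1)"
      by (simp add: has_field_derivative_iff)
    moreover have "filterlim c (at 1) sequentially"
      using ct c1(1)
        by (intro filterlim_atI) (auto simp: less_imp_neq[THEN not_sym] intro!: always_eventually)
    ultimately have "(\<lambda>k. (L 1 / c k ^ DIM('a) - L 1) / (c k - 1)) \<longlonglongrightarrow> - (DIM('a) * L 1)"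
      by (rule filterlim_compose)
    then show ?thesis by (simp add: scale)
  qed
  have "(\<integral>y. - (indicator (ball 0 1) y * (norm y * q y)) \<partial>lborel) = - (DIM('a) * L 1)"
    using LIMSEQ_unique[OF lim1] lim2 unfolding quot by blast
  then show ?thesis unfolding L_def set_lebesgue_integral_def by simp
qed

text \<open>Difference quotients integrate to 0 by translation invariance, and the Lipschitz bound
  dominates them. The derivative is asked for almost everywhere only, because the intended function
  has kinks at 0 and on the unit sphere.\<close>

lemma integral_directional_derivative_eq_0:
  fixes \<psi> d :: "'a::euclidean_space \<Rightarrow> real"
  assumes lip: "\<And>x y. \<bar>\<psi> x - \<psi> y\<bar> \<le> L * norm (x - y)"
    and supp: "\<And>y. norm y \<ge> 1 \<Longrightarrow> \<psi> y = 0" and e: "norm e = 1"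
    and der: "AE y in lborel. ((\<lambda>t. \<psi> (y + t *\<^sub>R e)) has_real_derivative d y) (at 0)"
    and d: "d \<in> borel_measurable borel"
  shows "(\<integral>y. d y \<partial>lborel) = 0"
proof -
  have L: "0 \<le> L" using order_trans[OF abs_ge_zero lip[of e 0]] e by simp
  have "isCont \<psi> x" for x
  proof -
    have "(\<lambda>y. L * norm (y - x)) \<midarrow>x\<rightarrow> 0"
      by (auto intro!: tendsto_eq_intros)
    then have "(\<lambda>y. \<psi> y - \<psi> x) \<midarrow>x\<rightarrow> 0"
      by (rule Lim_null_comparison[rotated]) (auto simp: lip)
    then show ?thesis by (simp add: isCont_def LIM_zero_iff)
  qed
  then have [measurable]: "\<psi> \<in> borel_measurable borel"
    by (intro borel_measurable_continuous_onI continuous_at_imp_continuous_on) auto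
  \<comment> \<open>Steps of length at most 1 keep the shifted support in the ball of radius
    2.\<close>
  define t where "t k = inverse (real (Suc k))" for k
  have t: "0 < t k" "t k \<le> 1" for k by (simp_all add: t_def inverse_le_1_iff)
  have t0: "t \<longlonglongrightarrow> 0" unfolding t_def by (rule LIMSEQ_inverse_real_of_nat)
  have int: "integrable lborel \<psi>"
  proof (rule integrable_lborel_cball[where a=0 and r=1 and C=L])
    show "\<bar>\<psi> y\<bar> \<le> L" if "y \<in> cball 0 1" for y
    proof -
      \<comment> \<open>A point of the unit sphere, where \<open>\<psi>\<close> vanishes, at
        distance at most 1 from \<open>y\<close>.\<close>
      obtain z :: 'a where z: "norm z = 1" "norm (y - z) \<le> 1"
      proof (cases "y = 0")
        case True
        then show ?thesis using that[of e] e by simp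
      next
        case False
        have "y - y /\<^sub>R norm y = (norm y - 1) *\<^sub>R (y /\<^sub>R norm y)"
          using False by (simp add: algebra_simps)
        moreover have "norm (y /\<^sub>R norm y) = 1" using False by simp
        ultimately have "norm (y - y /\<^sub>R norm y) = \<bar>norm y - 1\<bar>"
          by (metis mult_1_right norm_scaleR real_norm_def)
        then have "norm (y - y /\<^sub>R norm y) \<le> 1" using False \<open>y \<in> cball 0 1\<close> by simp
        then show ?thesis using that[of "y /\<^sub>R norm y"] False by simp
      qed
      then show ?thesis using lip[of y z] supp[of z] L mult_left_mono[of "norm (y - z)" 1 L] by simp
    qed
  qed (auto simp: supp)
  let ?s = "\<lambda>k y. (\<psi> (y + t k *\<^sub>R e) - \<psi> y) / t k"
  have int': "integrable lborel (\<lambda>y. \<psi> (y + t k *\<^sub>R e))" for k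
  proof -
    have "integrable (distr lborel borel ((+) (t k *\<^sub>R e))) \<psi>"
      using int by (simp only: lborel_distr_plus)
    from integrable_distr[OF _ this] show ?thesis by (simp add: add.commute)
  qed
  have "(\<integral>y. ?s k y \<partial>lborel) = 0" for k
    using int int'[of k] integral_lborel_translate[of \<psi> "t k *\<^sub>R e"] by simp
  moreover have "(\<lambda>k. \<integral>y. ?s k y \<partial>lborel) \<longlonglongrightarrow> (\<integral>y. d y \<partial>lborel)"
  proof (rule integral_dominated_convergence[where w="\<lambda>y. L * indicator (cball 0 2) y"])
    show "integrable lborel (\<lambda>y::'a. L * indicator (cball 0 2) y)"
      by (rule integrable_lborel_cball[where a=0 and r=2 and C=L])
        (use L in \<open>auto intro!: borel_measurable_times borel_measurable_indicator\<close>)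
    show "AE y in lborel. (\<lambda>k. ?s k y) \<longlonglongrightarrow> d y"
      using der
    proof eventually_elim
      case (elim y)
      then have "((\<lambda>s. (\<psi> (y + s *\<^sub>R e) - \<psi> y) / s) \<longlongrightarrow> d y) (at 0)"
        by (simp add: has_field_derivative_iff)
      moreover have "filterlim t (at 0) sequentially"
        using t0 t by (intro filterlim_atI) (auto simp: less_imp_neq[THEN not_sym] intro!: always_eventually)
      ultimately show ?case by (rule filterlim_compose)
    qed
    show "AE y in lborel. norm (?s k y) \<le> L * indicator (cball 0 2) y" for k
    proof (rule AE_I2)
      fix y :: 'a
      show "norm (?s k y) \<le> L * indicator (cball 0 2) y"
      proof (cases "norm y \<le> 2")
        case True
        then show ?thesis using lip[of "y + t k *\<^sub>R e" y] t[of k] e by (simp add: divide_simps)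
      next
        case False
        then have "norm (y + t k *\<^sub>R e) \<ge> 1"
          using norm_triangle_ineq2[of y "- (t k *\<^sub>R e)"] t[of k] e by simp
        then show ?thesis using False supp by simp
      qed
    qed
  qed (use d in measurable)
  ultimately have "(\<lambda>k::nat. 0) \<longlonglongrightarrow> (\<integral>y. d y \<partial>lborel)" by (simp only:)
  then show ?thesis by (simp add: LIMSEQ_const_iff)
qed

section \<open>Smooth support functions and the inverse Gauss map\<close>

text \<open>\<open>G\<close> is the gradient and \<open>G'\<close> the Hessian of \<open>H\<close>;
  for unit \<open>x\<close>, \<open>G x\<close> is the boundary point with outer normal
  \<open>x\<close>, so \<open>G\<close> is the inverse Gauss map. Positivity is asked on tangent
  vectors only, since homogeneity puts \<open>x\<close> into the kernel of
  \<open>G' x\<close>.\<close>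

locale smooth_support_function =
  fixes H :: "'a::euclidean_space \<Rightarrow> real" and G :: "'a \<Rightarrow> 'a" and G' :: "'a \<Rightarrow> 'a \<Rightarrow> 'a"
  assumes H_scale: "\<And>c y. 0 \<le> c \<Longrightarrow> H (c *\<^sub>R y) = c * H y"
    and G_scale: "\<And>c y. 0 < c \<Longrightarrow> G (c *\<^sub>R y) = G y"
    and H_deriv: "\<And>y. y \<noteq> 0 \<Longrightarrow> (H has_derivative (\<lambda>u. G y \<bullet> u)) (at y)"
    and G_deriv: "\<And>y. y \<noteq> 0 \<Longrightarrow> (G has_derivative G' y) (at y)"
    and H_pos: "\<And>y. y \<noteq> 0 \<Longrightarrow> 0 < H y"
    and G'_pos: "\<And>x u. norm x = 1 \<Longrightarrow> u \<bullet> x = 0 \<Longrightarrow> u \<noteq> 0 \<Longrightarrow> 0 < G' x u \<bullet> u"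
begin

lemma H_0 [simp]: "H 0 = 0"
  using H_scale[of 0 0] by simp

lemma linear_G': "y \<noteq> 0 \<Longrightarrow> linear (G' y)"
  using G_deriv has_derivative_linear by blast

lemma G_inner_self: assumes "y \<noteq> 0" shows "G y \<bullet> y = H y"
proof -
  have 1: "((\<lambda>s. s *\<^sub>R y) has_derivative (\<lambda>s. s *\<^sub>R y)) (at (1::real))"
    by (auto intro!: derivative_eq_intros)
  have "(H has_derivative (\<lambda>u. G y \<bullet> u)) (at (1 *\<^sub>R y))" using H_deriv[OF assms] by simp
  from diff_chain_at[OF 1 this] have "((\<lambda>s. H (s *\<^sub>R y)) has_derivative (\<lambda>s. G y \<bullet> (s *\<^sub>R y))) (at 1)"
    by (simp add: o_def)
  moreover have "((\<lambda>s. H (s *\<^sub>R y)) has_derivative (\<lambda>s. s * H y)) (at (1::real))"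
  proof (rule has_derivative_transform_within_open[where s="{0<..}" and f="\<lambda>s. s * H y"])
    show "((\<lambda>s. s * H y) has_derivative (\<lambda>s. s * H y)) (at (1::real))"
      by (auto intro!: derivative_eq_intros)
  qed (auto simp: H_scale)
  ultimately have "(\<lambda>s::real. G y \<bullet> (s *\<^sub>R y)) = (\<lambda>s. s * H y)" by (rule has_derivative_unique)
  from fun_cong[OF this, of 1] show ?thesis by simp
qed

lemma G'_self: assumes "y \<noteq> 0" shows "G' y y = 0"
proof -
  have 1: "((\<lambda>s. s *\<^sub>R y) has_derivative (\<lambda>s. s *\<^sub>R y)) (at (1::real))"
    by (auto intro!: derivative_eq_intros)
  have "(G has_derivative G' y) (at (1 *\<^sub>R y))" using G_deriv[OF assms] by simp
  from diff_chain_at[OF 1 this] have "((\<lambda>s. G (s *\<^sub>R y)) has_derivative (\<lambda>s. G' y (s *\<^sub>R y))) (at 1)"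
    by (simp add: o_def)
  moreover have "((\<lambda>s. G (s *\<^sub>R y)) has_derivative (\<lambda>s. 0)) (at (1::real))"
    by (rule has_derivative_transform_within_open[where s="{0<..}" and f="\<lambda>s. G y"])
       (auto simp: G_scale)
  ultimately have "(\<lambda>s::real. G' y (s *\<^sub>R y)) = (\<lambda>s. 0)" by (rule has_derivative_unique)
  from fun_cong[OF this, of 1] show ?thesis by simp
qed

text \<open>Differentiate Euler's relation \<open>G z \<bullet> z = H z\<close>: the term
  \<open>G y \<bullet> u\<close> already is the derivative of \<open>H\<close>, so the other term
  vanishes. This takes the place of symmetry of the Hessian.\<close>

lemma G'_inner_self: assumes "y \<noteq> 0" shows "G' y u \<bullet> y = 0"
proof -
  have "((\<lambda>z. G z \<bullet> z) has_derivative (\<lambda>u. G y \<bullet> u + G' y u \<bullet> y)) (at y)"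
    using G_deriv[OF assms] by (auto intro!: derivative_eq_intros)
  then have "(H has_derivative (\<lambda>u. G y \<bullet> u + G' y u \<bullet> y)) (at y)"
    by (rule has_derivative_transform_within_open[where s="- {0}"]) (use assms in \<open>auto simp: G_inner_self\<close>)
  from has_derivative_unique[OF this H_deriv[OF assms]] show ?thesis
    by (metis add_cancel_left_right)
qed

lemma G'_scale: assumes "y \<noteq> 0" "0 < c" shows "c *\<^sub>R G' (c *\<^sub>R y) u = G' y u"
proof -
  have 1: "((\<lambda>z. c *\<^sub>R z) has_derivative (\<lambda>z. c *\<^sub>R z)) (at y)"
    by (auto intro!: derivative_eq_intros)
  have "(G has_derivative G' (c *\<^sub>R y)) (at (c *\<^sub>R y))" using assms by (intro G_deriv) auto
  from diff_chain_at[OF 1 this] have "((\<lambda>z. G (c *\<^sub>R z)) has_derivative (\<lambda>u. G' (c *\<^sub>R y) (c *\<^sub>R u))) (at y)"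
    by (simp add: o_def)
  then have "(G has_derivative (\<lambda>u. G' (c *\<^sub>R y) (c *\<^sub>R u))) (at y)"
    using assms by (simp add: G_scale)
  from has_derivative_unique[OF this G_deriv[OF assms(1)]]
  have "G' (c *\<^sub>R y) (c *\<^sub>R u) = G' y u" by (rule fun_cong)
  then show ?thesis using linear_G'[of "c *\<^sub>R y"] assms by (simp add: linear_cmul)
qed

text \<open>The component of \<open>u\<close> along \<open>y\<close> is invisible to the quadratic
  form, by \<open>G'_self\<close> and \<open>G'_inner_self\<close>; the rest is tangent and
  nonzero.\<close>

lemma G'_quadratic_pos:
  assumes "y \<noteq> 0" and u: "\<And>a. u \<noteq> a *\<^sub>R y"
  shows "0 < G' y u \<bullet> u"
proof -
  define x where "x = y /\<^sub>R norm y"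
  have x: "norm x = 1" "y = norm y *\<^sub>R x" using assms(1) by (auto simp: x_def)
  then have "x \<noteq> 0" by auto
  define w where "w = u - (u \<bullet> x) *\<^sub>R x"
  have w: "w \<bullet> x = 0" using x(1) by (simp add: w_def inner_diff_left norm_eq_1)
  have "w \<noteq> 0"
  proof
    assume "w = 0"
    then have "u = ((u \<bullet> x) / norm y) *\<^sub>R y" by (simp add: w_def x_def divide_inverse)
    then show False using u by blast
  qed
  have eq: "G' x u = G' x w"
    using linear_G'[OF \<open>x \<noteq> 0\<close>] G'_self[OF \<open>x \<noteq> 0\<close>] by (simp add: w_def linear_diff linear_cmul)
  have "0 < G' x w \<bullet> w" by (rule G'_pos[OF x(1) w \<open>w \<noteq> 0\<close>])
  also have "G' x w \<bullet> w = G' x u \<bullet> u"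
    using G'_inner_self[OF \<open>x \<noteq> 0\<close>, of w] by (simp add: eq) (simp add: w_def inner_diff_right)
  finally have "0 < G' x u \<bullet> u" .
  moreover have "norm y *\<^sub>R G' y u = G' x u"
    using G'_scale[OF \<open>x \<noteq> 0\<close>, of "norm y" u] assms(1) x(2) by simp
  ultimately have "0 < norm y * (G' y u \<bullet> u)" by (metis inner_scaleR_left)
  then show ?thesis using assms(1) by (simp add: zero_less_mult_iff)
qed

text \<open>Strict convexity transversally to rays: along the segment from \<open>x\<close> to
  \<open>z\<close> the second derivative of \<open>H\<close> is positive, so the initial slope is
  below the mean slope. The strictness will make \<open>gauss\<close> injective.\<close>

lemma G_inner_less:
  assumes "x \<noteq> 0" and z: "\<And>c. 0 \<le> c \<Longrightarrow> z \<noteq> c *\<^sub>R x"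
  shows "G x \<bullet> z < H z"
proof -
  have "z \<noteq> 0" using z[of 0] by auto
  show ?thesis
  proof (cases "\<exists>c. z = c *\<^sub>R x")
    case True
    then obtain c where c: "z = c *\<^sub>R x" by blast
    then have "c < 0" using z[of c] not_le_imp_less by blast
    then have "G x \<bullet> z < 0" using H_pos[OF assms(1)] G_inner_self[OF assms(1)] c
      by (simp add: mult_neg_pos)
    then show ?thesis using H_pos[OF \<open>z \<noteq> 0\<close>] by linarith
  next
    case False
    define \<gamma> where "\<gamma> s = x + s *\<^sub>R (z - x)" for s
    \<comment> \<open>The segment has to avoid 0, where \<open>H_deriv\<close> says nothing.\<close>
    have gz: "\<gamma> s \<noteq> 0" for s
    proof
      assume a: "\<gamma> s = 0"
      then have "s *\<^sub>R z = (s - 1) *\<^sub>R x" by (simp add: \<gamma>_def algebra_simps)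
      moreover have "s \<noteq> 0" using a assms(1) by (auto simp: \<gamma>_def)
      ultimately have "z = ((s - 1) / s) *\<^sub>R x"
        by (metis (no_types) divide_inverse_commute scaleR_one left_inverse scaleR_scaleR)
      then show False using False by blast
    qed
    have d\<gamma>: "(\<gamma> has_derivative (\<lambda>h. h *\<^sub>R (z - x))) (at s)" for s
      unfolding \<gamma>_def by (auto intro!: derivative_eq_intros)
    have d1: "((\<lambda>s. H (\<gamma> s)) has_real_derivative G (\<gamma> s) \<bullet> (z - x)) (at s)" for s
      using diff_chain_at[OF d\<gamma> H_deriv[OF gz], of s]
      by (simp add: has_field_derivative_def o_def mult.commute[of _ "G (\<gamma> s) \<bullet> (z - x)"] mult_commute_abs)
    have d2: "((\<lambda>s. G (\<gamma> s) \<bullet> (z - x)) has_real_derivative G' (\<gamma> s) (z - x) \<bullet> (z - x)) (at s)" for s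
    proof -
      have "((\<lambda>s. G (\<gamma> s)) has_derivative (\<lambda>h. G' (\<gamma> s) (h *\<^sub>R (z - x)))) (at s)"
        using diff_chain_at[OF d\<gamma> G_deriv[OF gz], of s] by (simp add: o_def)
      then have "((\<lambda>s. G (\<gamma> s) \<bullet> (z - x)) has_derivative (\<lambda>h. G' (\<gamma> s) (h *\<^sub>R (z - x)) \<bullet> (z - x))) (at s)"
        by (rule has_derivative_inner_left)
      then show ?thesis using linear_G'[OF gz[of s]]
        by (simp add: has_field_derivative_def linear_cmul mult_commute_abs)
    qed
    have pos: "0 < G' (\<gamma> s) (z - x) \<bullet> (z - x)" for s
    proof (rule G'_quadratic_pos[OF gz])
      fix a
      show "z - x \<noteq> a *\<^sub>R \<gamma> s"
      proof
        assume a: "z - x = a *\<^sub>R \<gamma> s"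
        then have e: "(1 - a * s) *\<^sub>R z = (1 + a - a * s) *\<^sub>R x" by (simp add: \<gamma>_def algebra_simps)
        show False
        proof (cases "1 - a * s = 0")
          case True
          then have "(1 + a - a * s) = 0" using e assms(1) by simp
          then have "a = 0" using True by simp
          then show False using a False by (metis right_minus_eq scaleR_one scaleR_zero_left)
        next
          case nz: False
          then have "z = ((1 + a - a * s) / (1 - a * s)) *\<^sub>R x"
            using e by (metis (no_types) divide_inverse_commute scaleR_one left_inverse scaleR_scaleR)
          then show False using False by blast
        qed
      qed
    qed
    obtain \<xi> where \<xi>: "0 < \<xi>" "\<xi> < 1" and eq: "H (\<gamma> 1) - H (\<gamma> 0) = (1 - 0) * (G (\<gamma> \<xi>) \<bullet> (z - x))"
      using MVT2[of 0 1 "\<lambda>s. H (\<gamma> s)" "\<lambda>s. G (\<gamma> s) \<bullet> (z - x)"] d1 by auto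
    have "G (\<gamma> 0) \<bullet> (z - x) < G (\<gamma> \<xi>) \<bullet> (z - x)"
      using DERIV_pos_imp_increasing[OF \<xi>(1), of "\<lambda>s. G (\<gamma> s) \<bullet> (z - x)"] d2 pos by blast
    then show ?thesis using eq G_inner_self[OF assms(1)] by (simp add: \<gamma>_def inner_diff_right)
  qed
qed

lemma G_inner_le: assumes "x \<noteq> 0" shows "G x \<bullet> z \<le> H z"
proof (cases "\<exists>c\<ge>0. z = c *\<^sub>R x")
  case True
  then show ?thesis using G_inner_self[OF assms] H_scale by auto
next
  case False
  then show ?thesis using G_inner_less[OF assms, of z] by force
qed

lemma continuous_on_H: "continuous_on (- {0}) H"
  using H_deriv by (auto intro!: continuous_at_imp_continuous_on dest: has_derivative_continuous)

lemma continuous_on_G: "continuous_on (- {0}) G"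
  using G_deriv by (auto intro!: continuous_at_imp_continuous_on dest: has_derivative_continuous)

section \<open>The convex body and the inverse Gauss map extended to the ball\<close>

definition body where "body = {w. \<forall>x. w \<bullet> x \<le> H x}"

text \<open>The 1-homogeneous extension of the inverse Gauss map: the sphere of radius r goes to the
  boundary of the body scaled by r.\<close>

definition gauss where "gauss y = norm y *\<^sub>R G y"

text \<open>Together the two facts identify \<open>norm y\<close> as the gauge of
  \<open>body\<close> at \<open>w\<close>, the maximum of \<open>w \<bullet> z / H z\<close>,
  attained at \<open>z = y\<close>.\<close>

lemma gauss_eqD:
  assumes "gauss y = w" and "y \<noteq> 0"
  shows "w \<bullet> z \<le> norm y * H z" and "w \<bullet> y = norm y * H y"
  using assms G_inner_le[OF assms(2), of z] G_inner_self[OF assms(2)]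
  by (auto simp: gauss_def mult_left_mono)

text \<open>Equal images have equal gauge, hence equal norm; then \<open>G y = G y'\<close>, and the
  strict inequality \<open>G_inner_less\<close> puts \<open>y\<close> on the ray of
  \<open>y'\<close>.\<close>

lemma inj_on_gauss: "inj_on gauss (- {0})"
proof (rule inj_onI)
  have le: "norm y \<le> norm y'" if "gauss y = gauss y'" "y \<noteq> 0" "y' \<noteq> 0" for y y'
  proof -
    have "norm y * H y \<le> norm y' * H y"
      using gauss_eqD(1)[OF that(1)[symmetric] that(3), of y] gauss_eqD(2)[OF refl that(2)] that(1)
        by simp
    then show ?thesis using H_pos[OF that(2)] by simp
  qed
  fix y y' assume y: "y \<in> - {0}" "y' \<in> - {0}" and eq: "gauss y = gauss y'"
  then have n: "norm y = norm y'" by (auto intro!: antisym le)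
  then have "G y = G y'" using eq y by (simp add: gauss_def)
  then have "G y' \<bullet> y = H y" using G_inner_self[of y] y by simp
  then obtain c where c: "0 \<le> c" "y = c *\<^sub>R y'" using G_inner_less[of y' y] y by fastforce
  then have "c = 1" using n y by auto
  then show "y = y'" using c by simp
qed

text \<open>For surjectivity let \<open>x\<close> maximise \<open>w \<bullet> z / H z\<close> on the
  sphere, with value \<open>r\<close>. Then \<open>r * H z - w \<bullet> z\<close> is nonnegative
  and vanishes at \<open>x\<close>, so its derivative vanishes there, which reads
  \<open>w = r *\<^sub>R G x\<close>.\<close>

lemma gauss_image: "gauss ` (cball 0 1 - {0}) = body - {0}"
proof
  show "gauss ` (cball 0 1 - {0}) \<subseteq> body - {0}"
  proof safe
    fix y :: 'a assume y: "y \<in> cball 0 1" "y \<noteq> 0"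
    have "gauss y \<bullet> x \<le> H x" for x
    proof (cases "x = 0")
      case False
      have "gauss y \<bullet> x \<le> norm y * H x" using gauss_eqD(1)[OF refl y(2)] .
      also have "\<dots> \<le> 1 * H x" using y(1) H_pos[OF False] by (intro mult_right_mono) auto
      finally show ?thesis by simp
    qed simp
    then show "gauss y \<in> body" by (simp add: body_def)
    assume "gauss y = 0"
    then show False using gauss_eqD(2)[OF _ y(2), of 0] H_pos[OF y(2)] y(2) by simp
  qed
  show "body - {0} \<subseteq> gauss ` (cball 0 1 - {0})"
  proof
    fix w assume w: "w \<in> body - {0}"
    have sp: "sphere (0::'a) 1 \<noteq> {}" by simp
    have "continuous_on (sphere 0 1) (\<lambda>x. w \<bullet> x / H x)"
    proof (intro continuous_intros continuous_on_subset[OF continuous_on_H] ballI)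
      show "H x \<noteq> 0" if "x \<in> sphere 0 1" for x
        using H_pos[of x] that by force
    qed auto
    then obtain x where x: "x \<in> sphere 0 1" and mx: "\<And>z. z \<in> sphere 0 1 \<Longrightarrow> w \<bullet> z / H z \<le> w \<bullet> x / H x"
      using continuous_attains_sup[OF compact_sphere sp] by blast
    have x0: "x \<noteq> 0" using x by auto
    define r where "r = w \<bullet> x / H x"
    have "0 < w \<bullet> (w /\<^sub>R norm w) / H (w /\<^sub>R norm w)"
      using w by (intro divide_pos_pos H_pos) auto
    also have "\<dots> \<le> r" unfolding r_def using w by (intro mx) auto
    finally have r0: "0 < r" .
    have r1: "r \<le> 1" using w H_pos[OF x0] by (simp add: r_def body_def)
    have le: "w \<bullet> z \<le> r * H z" for z
    proof (cases "z = 0")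
      case False
      have "w \<bullet> (z /\<^sub>R norm z) / H (z /\<^sub>R norm z) \<le> r"
        unfolding r_def using False by (intro mx) auto
      moreover have "H (z /\<^sub>R norm z) = H z / norm z" by (simp add: H_scale divide_inverse_commute)
      ultimately show ?thesis using H_pos[OF False] False by (simp add: field_simps)
    qed simp
    have d: "((\<lambda>z. r * H z - w \<bullet> z) has_derivative (\<lambda>u. r * (G x \<bullet> u) - w \<bullet> u)) (at x)"
      by (intro derivative_intros H_deriv x0)
    have "r * H x - w \<bullet> x = 0" using H_pos[OF x0] by (simp add: r_def)
    then have "\<forall>\<^sub>F z in at x. r * H x - w \<bullet> x \<le> r * H z - w \<bullet> z"
      using le by (intro always_eventually) simp
    from has_derivative_local_min[OF d this]
    have "(\<lambda>u. r * (G x \<bullet> u) - w \<bullet> u) = (\<lambda>u. 0)" .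
    then have "(r *\<^sub>R G x - w) \<bullet> u = 0" for u by (metis inner_diff_left inner_scaleR_left)
    then have "(r *\<^sub>R G x - w) \<bullet> (r *\<^sub>R G x - w) = 0" .
    then have "w = r *\<^sub>R G x" by simp
    also have "\<dots> = gauss (r *\<^sub>R x)" using x r0 by (simp add: gauss_def G_scale)
    finally show "w \<in> gauss ` (cball 0 1 - {0})" using x r0 r1 x0 by auto
  qed
qed

lemma body_bounds:
  assumes "0 \<le> m" and "\<And>x. norm x = 1 \<Longrightarrow> m \<le> H x" and "\<And>x. norm x = 1 \<Longrightarrow> H x \<le> M"
  shows "cball 0 m \<subseteq> body" and "body \<subseteq> cball 0 M"
proof -
  have H: "H x = norm x * H (x /\<^sub>R norm x)" for x
    by (cases "x = 0") (auto simp: H_scale)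
  show "cball 0 m \<subseteq> body"
    unfolding body_def
  proof safe
    fix w x :: 'a assume w: "w \<in> cball 0 m"
    have "w \<bullet> x \<le> norm x * norm w" using norm_cauchy_schwarz[of w x] by (simp add: mult.commute)
    also have "\<dots> \<le> norm x * m" using w by (intro mult_left_mono) auto
    also have "\<dots> \<le> H x"
      using assms(2)[of "x /\<^sub>R norm x"] by (subst H) (cases "x = 0", auto intro: mult_left_mono)
    finally show "w \<bullet> x \<le> H x" .
  qed
  show "body \<subseteq> cball 0 M"
  proof
    fix w assume w: "w \<in> body"
    have M: "0 \<le> M"
    proof -
      obtain x :: 'a where "norm x = 1" using vector_choose_size[of 1] by auto
      then show ?thesis using assms(1) assms(2,3)[of x] by linarith
    qed
    have "w \<bullet> w \<le> H w" using w by (simp add: body_def)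
    also have "\<dots> \<le> norm w * M"
      using assms(3)[of "w /\<^sub>R norm w"] by (subst H) (cases "w = 0", auto intro: mult_left_mono)
    finally have "norm w * norm w \<le> norm w * M"
      by (simp add: power2_norm_eq_inner flip: power2_eq_square)
    then show "w \<in> cball 0 M" using M by (cases "w = 0") auto
  qed
qed

lemma norm_G_le:
  assumes "\<And>x. norm x = 1 \<Longrightarrow> H x \<le> M" and "y \<noteq> 0"
  shows "norm (G y) \<le> M"
proof -
  have "G y \<in> body" using G_inner_le[OF assms(2)] by (simp add: body_def)
  moreover have "\<And>x. norm x = 1 \<Longrightarrow> 0 \<le> H x" using H_pos by (metis less_imp_le norm_zero zero_neq_one)
  ultimately show ?thesis using body_bounds(2)[of 0 M] assms(1) by (auto simp: subset_iff)
qed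

text \<open>By \<open>G_inner_le\<close> the gradient at \<open>x\<close> alone bounds
  \<open>H x - H y\<close>, so it does not matter whether the segment meets 0.\<close>

lemma H_lipschitz:
  assumes "\<And>x. norm x = 1 \<Longrightarrow> H x \<le> M"
  shows "\<bar>H x - H y\<bar> \<le> M * norm (x - y)"
proof -
  have *: "H x - H y \<le> M * norm (x - y)" for x y
  proof (cases "x = 0")
    case True
    have "- H y \<le> 0" using H_pos[of y] by (cases "y = 0") auto
    moreover have "0 \<le> M" using assms H_pos
      by (metis less_le_trans less_imp_le norm_zero vector_choose_size zero_le_one zero_neq_one)
    ultimately show ?thesis using True by (simp add: order_trans[of _ 0])
  next
    case False
    have "H x - H y \<le> G x \<bullet> (x - y)"
      using G_inner_self[OF False] G_inner_le[OF False, of y] by (simp add: inner_diff_right)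
    also have "\<dots> \<le> norm (G x) * norm (x - y)" by (rule norm_cauchy_schwarz)
    also have "\<dots> \<le> M * norm (x - y)" by (intro mult_right_mono norm_G_le assms False) auto
    finally show ?thesis .
  qed
  show ?thesis using *[of x y] *[of y x] by (simp add: norm_minus_commute)
qed

text \<open>The body is moved by \<open>v\<close>; the bound on \<open>v\<close> keeps the origin in
  its interior.\<close>

lemma translate:
  assumes "\<And>x. norm x = 1 \<Longrightarrow> norm v < H x"
  shows "smooth_support_function (\<lambda>y. H y + v \<bullet> y) (\<lambda>y. G y + v) G'"
proof
  show "0 < H y + v \<bullet> y" if "y \<noteq> 0" for y
  proof -
    have "norm v * norm y < H (y /\<^sub>R norm y) * norm y"
      using that by (intro mult_strict_right_mono assms) auto
    also have "\<dots> = H y" using that by (simp add: H_scale)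
    finally show ?thesis using Cauchy_Schwarz_ineq2[of v y] by linarith
  qed
  show "((\<lambda>y. G y + v) has_derivative G' y) (at y)" if "y \<noteq> 0" for y
    using has_derivative_add_const[OF G_deriv[OF that]] .
  show "((\<lambda>y. H y + v \<bullet> y) has_derivative (\<lambda>u. (G y + v) \<bullet> u)) (at y)" if "y \<noteq> 0" for y
    using H_deriv[OF that] by (auto intro!: derivative_eq_intros simp: inner_add_left)
qed (auto simp: H_scale G_scale algebra_simps G'_pos)

end

section \<open>Moments of the body\<close>

abbreviation punctured_ball :: "'a::real_normed_vector set" where
  "punctured_ball \<equiv> cball 0 1 - {0}"

text \<open>The bound is on the punctured ball only, the domain of all the integrals below;
  \<open>norm\<close> and functions that are odd at 0 then qualify.\<close>

definition bounded_borel :: "('a::euclidean_space \<Rightarrow> real) \<Rightarrow> bool" where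
  "bounded_borel q \<longleftrightarrow> q \<in> borel_measurable borel \<and> (\<exists>C. \<forall>y\<in>punctured_ball. \<bar>q y\<bar> \<le> C)"

lemma bounded_borelI:
  "q \<in> borel_measurable borel \<Longrightarrow> (\<And>y. y \<in> punctured_ball \<Longrightarrow> \<bar>q y\<bar> \<le> C) \<Longrightarrow> bounded_borel q"
  unfolding bounded_borel_def by blast

lemma bounded_borel_const: "bounded_borel (\<lambda>_. c)"
  by (rule bounded_borelI[where C="\<bar>c\<bar>"]) auto

lemma bounded_borel_add:
  assumes "bounded_borel p" "bounded_borel q" shows "bounded_borel (\<lambda>y. p y + q y)"
proof -
  obtain C C' where "\<forall>y\<in>punctured_ball. \<bar>p y\<bar> \<le> C" "\<forall>y\<in>punctured_ball. \<bar>q y\<bar> \<le> C'"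
    using assms unfolding bounded_borel_def by blast
  then show ?thesis using assms unfolding bounded_borel_def
    by (intro conjI exI[of _ "C + C'"] borel_measurable_add) (auto intro!: order_trans[OF abs_triangle_ineq] add_mono)
qed

lemma bounded_borel_mult:
  assumes "bounded_borel p" "bounded_borel q" shows "bounded_borel (\<lambda>y. p y * q y)"
proof -
  obtain C C' where C: "\<forall>y\<in>punctured_ball. \<bar>p y\<bar> \<le> C" "\<forall>y\<in>punctured_ball. \<bar>q y\<bar> \<le> C'"
    using assms unfolding bounded_borel_def by blast
  have "\<bar>p y * q y\<bar> \<le> C * C'" if "y \<in> punctured_ball" for y
    unfolding abs_mult using C that by (intro mult_mono) (auto intro: order_trans[OF abs_ge_zero])
  then show ?thesis using assms unfolding bounded_borel_def
    by (intro conjI exI[of _ "C * C'"] borel_measurable_times) auto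
qed

lemma bounded_borel_diff:
  assumes "bounded_borel p" "bounded_borel q" shows "bounded_borel (\<lambda>y. p y - q y)"
  using bounded_borel_add[OF assms(1) bounded_borel_mult[OF bounded_borel_const[of "-1"] assms(2)]]
    by simp

lemma bounded_borel_norm: "bounded_borel (\<lambda>y. norm y)"
  by (rule bounded_borelI[where C=1]) auto

lemma borel_measurable_sgn_vec [measurable]: "(sgn :: 'a \<Rightarrow> 'a::euclidean_space) \<in> borel_measurable borel"
  unfolding sgn_div_norm[abs_def] by measurable

lemma bounded_borel_inner_sgn: "bounded_borel (\<lambda>y. e \<bullet> sgn y)"
  by (rule bounded_borelI[where C="norm e"])
     (auto intro!: order_trans[OF Cauchy_Schwarz_ineq2] simp: norm_sgn)

lemmas bounded_borel_intros = bounded_borel_const bounded_borel_add bounded_borel_mult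
  bounded_borel_diff bounded_borel_norm bounded_borel_inner_sgn

lemma borel_punctured_ball: "punctured_ball \<in> sets (borel :: 'a::euclidean_space measure)"
  by auto

lemma set_integrable_punctured_ball:
  assumes "bounded_borel q" shows "set_integrable lborel punctured_ball q"
proof -
  have "bounded (punctured_ball :: 'a set)" by (rule bounded_subset[OF bounded_cball]) auto
  with assms borel_punctured_ball show ?thesis
    unfolding bounded_borel_def by (auto intro: set_integrable_lborel_bounded)
qed

lemma set_integral_cong_negligible_diff:
  fixes q r :: "'a::euclidean_space \<Rightarrow> real"
  assumes "S \<in> sets borel" "T \<in> sets borel" "q \<in> borel_measurable borel" "r \<in> borel_measurable borel"
    and "AE y in lborel. indicator S y * q y = indicator T y * r y"
  shows "(LINT y:S|lborel. q y) = (LINT y:T|lborel. r y)"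
  unfolding set_lebesgue_integral_def using assms by (intro integral_cong_AE) auto

text \<open>For \<open>w = G y\<close> the map in \<open>det_G'\<close> is the derivative of
  \<open>gauss\<close> at \<open>y\<close>. Having it for every \<open>w\<close> makes the
  assumption survive translation, where \<open>w = G y + v\<close>. \<open>D\<close> is the density
  of the surface area measure, that is, the determinant of the Hessian of \<open>H\<close> on the
  tangent space.\<close>

locale support_function_with_density = smooth_support_function H G G'
  for H :: "real^'m::finite \<Rightarrow> real" and G G' +
  fixes D :: "real^'m \<Rightarrow> real" and m M :: real
  assumes det_G': "\<And>y w. y \<noteq> 0 \<Longrightarrow>
      det (matrix (\<lambda>u. (sgn y \<bullet> u) *\<^sub>R w + norm y *\<^sub>R G' y u)) = (sgn y \<bullet> w) * D y"
    and D_nonneg: "\<And>y. y \<noteq> 0 \<Longrightarrow> 0 \<le> D y" and bounded_borel_D: "bounded_borel D"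
    and m_pos: "0 < m" and H_ge: "\<And>x. norm x = 1 \<Longrightarrow> m \<le> H x"
    and H_le: "\<And>x. norm x = 1 \<Longrightarrow> H x \<le> M"
begin

lemma borel_H: "H \<in> borel_measurable borel" and borel_G: "G \<in> borel_measurable borel"
  using borel_measurable_continuous_countable_exceptions[OF _ continuous_on_H]
    borel_measurable_continuous_countable_exceptions[OF _ continuous_on_G] by auto

lemma H_sgn: "H y = norm y * H (sgn y)"
  by (cases "y = 0") (auto simp: sgn_div_norm H_scale)

lemma bounded_borel_H: "bounded_borel (\<lambda>y. H (sgn y))"
proof (rule bounded_borelI[where C=M])
  show "(\<lambda>y. H (sgn y)) \<in> borel_measurable borel" using borel_H by measurable
  show "\<bar>H (sgn y)\<bar> \<le> M" if "y \<in> punctured_ball" for y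
    using that H_ge[of "sgn y"] H_le[of "sgn y"] m_pos by (auto simp: norm_sgn)
qed

lemma bounded_borel_G: "bounded_borel (\<lambda>y. e \<bullet> G y)"
proof (rule bounded_borelI[where C="norm e * M"])
  show "(\<lambda>y. e \<bullet> G y) \<in> borel_measurable borel" using borel_G by measurable
  show "\<bar>e \<bullet> G y\<bar> \<le> norm e * M" if "y \<in> punctured_ball" for y
    using order_trans[OF Cauchy_Schwarz_ineq2[of e "G y"] mult_left_mono[OF norm_G_le[OF H_le]]] that
    by auto
qed

lemma closed_body: "closed body"
proof -
  have "body = (\<Inter>x. {w. w \<bullet> x \<le> H x})" by (auto simp: body_def)
  moreover have "closed {w. w \<bullet> x \<le> H x}" for x
    using closed_halfspace_le[of x "H x"] by (simp add: inner_commute)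
  ultimately show ?thesis by auto
qed

lemma borel_body: "body \<in> sets borel" using closed_body by auto

lemma bounded_body: "bounded body"
  using body_bounds(2)[OF _ H_ge H_le] m_pos by (meson bounded_cball bounded_subset less_imp_le)

text \<open>Substitution along \<open>gauss\<close>: by Euler's relation its Jacobian
  \<open>(sgn y \<bullet> G y) * D y\<close> is \<open>H (sgn y) * D y\<close>.\<close>

lemma body_integral:
  assumes \<phi>: "\<phi> \<in> borel_measurable borel" and bb: "bounded_borel (\<lambda>y. \<phi> (gauss y))"
  shows "(LINT w:body|lborel. \<phi> w) = (LINT y:punctured_ball|lborel. H (sgn y) * D y * \<phi> (gauss y))"
proof -
  define g' where "g' y u = (sgn y \<bullet> u) *\<^sub>R G y + norm y *\<^sub>R G' y u" for y u
  have der: "(gauss has_derivative g' y) (at y)" if "y \<in> punctured_ball" for y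
    unfolding g'_def gauss_def[abs_def] using that
    by (auto intro!: derivative_eq_intros G_deriv has_derivative_norm simp: add.commute inner_commute)
  have det: "\<bar>det (matrix (g' y))\<bar> = H (sgn y) * D y" if "y \<in> punctured_ball" for y
  proof -
    have y: "y \<noteq> 0" using that by simp
    have "sgn y \<bullet> G y = H y / norm y"
      using G_inner_self[OF y] by (simp add: sgn_div_norm inner_commute divide_inverse_commute)
    also have "\<dots> = H (sgn y)" using y H_sgn[of y] by simp
    finally have "det (matrix (g' y)) = H (sgn y) * D y"
      unfolding g'_def using det_G'[OF y, of "G y"] by simp
    moreover have "0 \<le> H (sgn y) * D y"
      using y D_nonneg H_pos[of "sgn y"] by (simp add: sgn_zero_iff)
    ultimately show ?thesis by simp
  qed
  have cong: "indicator punctured_ball y * (\<bar>det (matrix (g' y))\<bar> * \<phi> (gauss y)) =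
      indicator punctured_ball y * (H (sgn y) * D y * \<phi> (gauss y))" for y
    using det[of y] by (cases "y \<in> punctured_ball") auto
  have inj: "inj_on gauss punctured_ball" using inj_on_gauss by (rule inj_on_subset) auto
  have "bounded_borel (\<lambda>y. H (sgn y) * D y * \<phi> (gauss y))"
    by (intro bounded_borel_intros bounded_borel_H bounded_borel_D bb)
  then have "set_integrable lborel punctured_ball (\<lambda>y. H (sgn y) * D y * \<phi> (gauss y))"
    by (rule set_integrable_punctured_ball)
  then have int: "set_integrable lborel punctured_ball (\<lambda>y. \<bar>det (matrix (g' y))\<bar> * \<phi> (gauss y))"
    unfolding set_integrable_def real_scaleR_def cong .
  have im: "gauss ` punctured_ball \<in> sets borel" unfolding gauss_image using borel_body by auto
  have "(LINT w:body|lborel. \<phi> w) = (LINT w:body - {0}|lborel. \<phi> w)"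
  proof (rule set_integral_cong_negligible_diff)
    show "AE w in lborel. indicator body w * \<phi> w = indicator (body - {0}) w * \<phi> w"
      using AE_lborel_singleton[of 0] by eventually_elim (auto simp: indicator_def)
  qed (use borel_body \<phi> in auto)
  also have "\<dots> = (LINT w:gauss ` punctured_ball|lborel. \<phi> w)" by (simp add: gauss_image)
  also have "\<dots> = (LINT y:punctured_ball|lborel. \<bar>det (matrix (g' y))\<bar> * \<phi> (gauss y))"
    by (rule change_of_variables(2)[OF borel_punctured_ball im der inj \<phi> int])
  also have "\<dots> = (LINT y:punctured_ball|lborel. H (sgn y) * D y * \<phi> (gauss y))"
    unfolding set_lebesgue_integral_def real_scaleR_def cong ..
  finally show ?thesis .
qed

lemma translate_density:
  assumes "norm v < m"
  shows "support_function_with_density (\<lambda>y. H y + v \<bullet> y) (\<lambda>y. G y + v) G' D (m - norm v) (M + norm v)"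
proof -
  interpret t: smooth_support_function "\<lambda>y. H y + v \<bullet> y" "\<lambda>y. G y + v" G'
    by (rule translate) (use assms H_ge in force)
  show ?thesis
  proof
    fix x :: "real^'m" assume x: "norm x = 1"
    have "\<bar>v \<bullet> x\<bar> \<le> norm v" using Cauchy_Schwarz_ineq2[of v x] x by simp
    then show "m - norm v \<le> H x + v \<bullet> x" "H x + v \<bullet> x \<le> M + norm v"
      using H_ge[OF x] H_le[OF x] by auto
  qed (use assms det_G' D_nonneg bounded_borel_D in auto)
qed

lemma body_translate:
  "smooth_support_function.body (\<lambda>y. H y + v \<bullet> y) = (\<lambda>w. w - v) -` body" if "norm v < m"
proof -
  interpret t: smooth_support_function "\<lambda>y. H y + v \<bullet> y" "\<lambda>y. G y + v" G'
    by (rule translate) (use that H_ge in force)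
  show ?thesis by (auto simp: t.body_def body_def algebra_simps)
qed

lemma body_integral_translate:
  assumes v: "norm v < m" and [measurable]: "\<phi> \<in> borel_measurable borel"
    and bb: "bounded_borel (\<lambda>y. \<phi> (norm y *\<^sub>R (G y + v)))"
  shows "(LINT w:body|lborel. \<phi> (w + v)) =
    (LINT y:punctured_ball|lborel. (H (sgn y) + v \<bullet> sgn y) * D y * \<phi> (norm y *\<^sub>R (G y + v)))"
proof -
  interpret t: support_function_with_density "\<lambda>y. H y + v \<bullet> y" "\<lambda>y. G y + v" G' D "m - norm v" "M + norm v"
    by (rule translate_density[OF v])
  have [measurable]: "body \<in> sets borel" by (rule borel_body)
  have "(LINT w:body|lborel. \<phi> (w + v)) = (\<integral>w. (\<lambda>w. indicator body (w - v) * \<phi> w) (w + v) \<partial>lborel)"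
    by (simp add: set_lebesgue_integral_def)
  also have "\<dots> = (\<integral>w. indicator body (w - v) * \<phi> w \<partial>lborel)"
    by (rule integral_lborel_translate) measurable
  also have "\<dots> = (LINT w:t.body|lborel. \<phi> w)"
    unfolding body_translate[OF v] set_lebesgue_integral_def
    by (auto intro!: Bochner_Integration.integral_cong simp: indicator_def)
  finally show ?thesis using t.body_integral[of \<phi>] bb by (simp add: t.gauss_def)
qed

lemma volume_body_eq:
  "(LINT w:body|lborel. 1) = (LINT y:punctured_ball|lborel. H (sgn y) * D y)"
  using body_integral[of "\<lambda>_. 1"] by (simp add: bounded_borel_const)

text \<open>The volume of the translate by \<open>v\<close> is given by a formula affine in
  \<open>v\<close> but does not depend on \<open>v\<close>, so the linear part vanishes.\<close>

lemma integral_inner_density_eq_0: "(LINT y:punctured_ball|lborel. (e \<bullet> sgn y) * D y) = 0"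
proof (cases "e = 0")
  case False
  define v where "v = (m / (2 * norm e)) *\<^sub>R e"
  have v: "norm v < m" using False m_pos by (simp add: v_def)
  have "(LINT y:punctured_ball|lborel. H (sgn y) * D y) =
      (LINT y:punctured_ball|lborel. (H (sgn y) + v \<bullet> sgn y) * D y)"
    using body_integral_translate[OF v, of "\<lambda>_. 1"] volume_body_eq
      by (simp add: bounded_borel_const)
  also have "\<dots> = (LINT y:punctured_ball|lborel. H (sgn y) * D y) + (LINT y:punctured_ball|lborel. (v \<bullet> sgn y) * D y)"
    unfolding distrib_right
    by (intro set_integral_add set_integrable_punctured_ball bounded_borel_intros bounded_borel_H bounded_borel_D)
  finally have "(LINT y:punctured_ball|lborel. m / (2 * norm e) * ((e \<bullet> sgn y) * D y)) = 0"
    by (simp add: v_def mult.assoc)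
  then show ?thesis using False m_pos by simp
qed simp

text \<open>Moving the body by \<open>s *\<^sub>R e\<close> adds s times the volume to the integral
  of e \<bullet> w. In the transformed integral the difference between s = t and s = -t removes the
  terms of degree 0 and 2 in s.\<close>

lemma integral_first_moment:
  assumes e: "norm e = 1"
  shows "(LINT y:punctured_ball|lborel. norm y * (H (sgn y) * D y + (e \<bullet> G y) * ((e \<bullet> sgn y) * D y)))
    = (LINT y:punctured_ball|lborel. H (sgn y) * D y)"
proof -
  define t where "t = m / 2"
  have t: "0 < t" "t < m" using m_pos by (simp_all add: t_def)
  have ee: "e \<bullet> e = 1" using e by (simp add: norm_eq_1)
  let ?I = "\<lambda>q. LINT y:punctured_ball|lborel. q y"
  have *: "(LINT w:body|lborel. e \<bullet> w) + s * (LINT w:body|lborel. 1) =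
      ?I (\<lambda>y. (H (sgn y) + s * (e \<bullet> sgn y)) * D y * (norm y * (e \<bullet> G y + s)))" if "\<bar>s\<bar> < m" for s
  proof -
    have bb: "bounded_borel (\<lambda>y. e \<bullet> (norm y *\<^sub>R (G y + s *\<^sub>R e)))"
      by (simp add: inner_add_right) (intro bounded_borel_intros bounded_borel_G)
    obtain C where C: "\<And>w. w \<in> body \<Longrightarrow> norm w \<le> C" using bounded_body bounded_iff by blast
    have "set_integrable lborel body (\<lambda>w. e \<bullet> w)" "set_integrable lborel body (\<lambda>w. s)"
      by (rule set_integrable_lborel_bounded[OF borel_body bounded_body, where C=C],
          use C Cauchy_Schwarz_ineq2[of e] e in \<open>auto intro: order_trans\<close>)
         (rule set_integrable_lborel_bounded[OF borel_body bounded_body, where C="\<bar>s\<bar>"], auto)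
    then have "(LINT w:body|lborel. e \<bullet> (w + s *\<^sub>R e)) = (LINT w:body|lborel. e \<bullet> w) + (LINT w:body|lborel. s * 1)"
      by (simp add: inner_add_right ee)
    moreover have "(LINT w:body|lborel. s * 1) = s * (LINT w:body|lborel. 1)"
      by (rule set_integral_mult_right)
    ultimately show ?thesis
      using body_integral_translate[of "s *\<^sub>R e" "\<lambda>w. e \<bullet> w"] that e bb
      by (simp add: inner_add_right ee)
  qed
  have bb: "bounded_borel (\<lambda>y. (H (sgn y) + s * (e \<bullet> sgn y)) * D y * (norm y * (e \<bullet> G y + s)))" for s
    by (intro bounded_borel_intros bounded_borel_H bounded_borel_D bounded_borel_G)
  have "2 * t * (LINT w:body|lborel. 1) =
      ?I (\<lambda>y. (H (sgn y) + t * (e \<bullet> sgn y)) * D y * (norm y * (e \<bullet> G y + t)))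
    - ?I (\<lambda>y. (H (sgn y) + (-t) * (e \<bullet> sgn y)) * D y * (norm y * (e \<bullet> G y + (-t))))"
    using *[of t] *[of "-t"] t by simp
  also have "\<dots> = ?I (\<lambda>y. (H (sgn y) + t * (e \<bullet> sgn y)) * D y * (norm y * (e \<bullet> G y + t))
      - (H (sgn y) + (-t) * (e \<bullet> sgn y)) * D y * (norm y * (e \<bullet> G y + (-t))))"
    by (intro set_integral_diff(2)[symmetric] set_integrable_punctured_ball bb)
  also have "\<dots> = ?I (\<lambda>y. (2 * t) * (norm y * (H (sgn y) * D y + (e \<bullet> G y) * ((e \<bullet> sgn y) * D y))))"
    by (rule arg_cong[where f="?I"], rule ext) (simp add: algebra_simps)
  also have "\<dots> = 2 * t * ?I (\<lambda>y. norm y * (H (sgn y) * D y + (e \<bullet> G y) * ((e \<bullet> sgn y) * D y)))"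
    by (rule set_integral_mult_right)
  finally show ?thesis using t by (simp add: volume_body_eq)
qed

end

section \<open>Isotropy\<close>

lemma AE_norm_neq_1: "AE y in lborel. norm (y::'a::euclidean_space) \<noteq> 1"
proof -
  have "negligible (sphere (0::'a) 1)" by (rule negligible_sphere)
  then have "sphere (0::'a) 1 \<in> null_sets lebesgue" by (simp add: negligible_iff_null_sets)
  then have "sphere (0::'a) 1 \<in> null_sets lborel"
    by (subst (asm) null_sets_completion_iff) auto
  then show ?thesis by (rule AE_I') auto
qed

text \<open>In polar coordinates the radial factors are the integrals over [0,1] of r^N and of (1 -
  r) r^(N-1), which are 1/(N+1) and 1/(N(N+1)). This converts between the weights in which the
  moment identity and the integration by parts come out.\<close>

lemma integral_norm_mult_radial:
  fixes q :: "'a::euclidean_space \<Rightarrow> real"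
  assumes bb: "bounded_borel q" and hom: "\<And>c y. c > 0 \<Longrightarrow> q (c *\<^sub>R y) = q y"
  shows "(LINT y:punctured_ball|lborel. norm y * q y) = DIM('a) * (LINT y:punctured_ball|lborel. (1 - norm y) * q y)"
proof -
  obtain C where C: "\<And>y. y \<in> punctured_ball \<Longrightarrow> \<bar>q y\<bar> \<le> C" and [measurable]: "q \<in> borel_measurable borel"
    using bb unfolding bounded_borel_def by blast
  have "\<bar>q y\<bar> \<le> max C \<bar>q 0\<bar>" for y
  proof (cases "y = 0")
    case False
    then have "q y = q ((1 / norm y) *\<^sub>R y)" by (subst hom) auto
    then show ?thesis using C[of "(1 / norm y) *\<^sub>R y"] False by simp
  qed simp
  then have "(LINT y:ball 0 1|lborel. norm y * q y) = DIM('a) * (\<integral>y. max 0 (1 - norm y) * q y \<partial>lborel)"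
    by (intro integral_norm_mult_homogeneous hom) auto
  moreover have "(LINT y:ball 0 1|lborel. norm y * q y) = (LINT y:punctured_ball|lborel. norm y * q y)"
  proof (rule set_integral_cong_negligible_diff)
    show "AE y in lborel. indicator (ball 0 1) y * (norm y * q y) = indicator punctured_ball y * (norm y * q y)"
      using AE_norm_neq_1 by eventually_elim (auto simp: indicator_def)
  qed (auto, measurable)
  moreover have "(\<integral>y. max 0 (1 - norm y) * q y \<partial>lborel) = (LINT y:punctured_ball|lborel. (1 - norm y) * q y)"
    unfolding set_lebesgue_integral_def
  proof (rule integral_cong_AE)
    have [measurable]: "punctured_ball \<in> sets (borel :: 'a measure)" by (rule borel_punctured_ball)
    show "(\<lambda>y. indicator punctured_ball y *\<^sub>R ((1 - norm y) * q y)) \<in> borel_measurable lborel"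
      by measurable
    show "AE y in lborel. max 0 (1 - norm y) * q y = indicator punctured_ball y *\<^sub>R ((1 - norm y) * q y)"
      using AE_lborel_singleton[of 0] by eventually_elim (auto simp: indicator_def)
  qed measurable
  ultimately show ?thesis by simp
qed

lemma integral_radial:
  fixes q :: "'a::euclidean_space \<Rightarrow> real"
  assumes bb: "bounded_borel q" and hom: "\<And>c y. c > 0 \<Longrightarrow> q (c *\<^sub>R y) = q y"
  shows "(LINT y:punctured_ball|lborel. q y) = (DIM('a) + 1) * (LINT y:punctured_ball|lborel. (1 - norm y) * q y)"
proof -
  have "(LINT y:punctured_ball|lborel. q y) = (LINT y:punctured_ball|lborel. (1 - norm y) * q y + norm y * q y)"
    by (simp add: algebra_simps)
  also have "\<dots> = (LINT y:punctured_ball|lborel. (1 - norm y) * q y) + (LINT y:punctured_ball|lborel. norm y * q y)"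
    by (intro set_integral_add set_integrable_punctured_ball bounded_borel_intros bb)
  finally show ?thesis using integral_norm_mult_radial[OF assms] by (simp add: algebra_simps)
qed

section \<open>Lipschitz estimates for the test function\<close>

lemma norm_sgn_diff_le: "norm x * norm (sgn x - sgn y) \<le> 2 * norm (x - y)"
  for x y :: "'a::real_inner"
proof (cases "x = 0 \<or> y = 0")
  case False
  then have "norm x *\<^sub>R (sgn x - sgn y) = (x - y) + (norm y - norm x) *\<^sub>R sgn y"
    by (simp add: sgn_div_norm algebra_simps)
  then have "norm x * norm (sgn x - sgn y) = norm ((x - y) + (norm y - norm x) *\<^sub>R sgn y)"
    by (metis abs_norm_cancel norm_scaleR)
  also have "\<dots> \<le> norm (x - y) + \<bar>norm y - norm x\<bar>"
    using norm_triangle_ineq[of "x - y" "(norm y - norm x) *\<^sub>R sgn y"] False by (simp add: norm_sgn)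
  also have "\<dots> \<le> 2 * norm (x - y)"
    using norm_triangle_ineq3[of y x] by (simp add: norm_minus_commute)
  finally show ?thesis .
qed (auto simp: norm_sgn)

text \<open>A 0-homogeneous function is in general discontinuous at 0 and has Lipschitz constant of
  order 1/|x|, hence the weight \<open>norm x\<close> in the assumption. The factor
  \<open>e \<bullet> y\<close>, of size at most |y|, compensates for both.\<close>

lemma lipschitz_cone_mult:
  fixes e :: "'a::euclidean_space" and F :: "'a \<Rightarrow> real"
  assumes e: "norm e = 1" and F: "\<And>x. \<bar>F x\<bar> \<le> B"
    and lip: "\<And>x y. x \<noteq> 0 \<Longrightarrow> y \<noteq> 0 \<Longrightarrow> norm x * \<bar>F x - F y\<bar> \<le> K * norm (x - y)"
  defines "\<psi> \<equiv> \<lambda>y. (e \<bullet> y) * max 0 (1 - norm y) * F y"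
  shows "\<bar>\<psi> x - \<psi> y\<bar> \<le> (K + 2 * B) * norm (x - y)"
proof -
  define A where "A y = (e \<bullet> y) * max 0 (1 - norm y)" for y
  have B: "0 \<le> B" using F[of 0] by linarith
  \<comment> \<open>\<open>e\<close> and \<open>2 *\<^sub>R e\<close> are nonzero points at distance
    1, so \<open>lip\<close> forces \<open>0 \<le> K\<close>.\<close>
  have K: "0 \<le> K"
  proof -
    have "e - 2 *\<^sub>R e = - e" by (simp add: scaleR_2)
    then show ?thesis
      using order_trans[OF mult_nonneg_nonneg[OF norm_ge_zero abs_ge_zero] lip[of e "2 *\<^sub>R e"]] e
        by force
  qed
  have ey: "\<bar>e \<bullet> y\<bar> \<le> norm y" for y using Cauchy_Schwarz_ineq2[of e y] e by simp
  have k1: "\<bar>max 0 (1 - norm y)\<bar> \<le> 1" for y :: 'a by (auto simp: max_def)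
  have A_le: "\<bar>A y\<bar> \<le> norm y" for y
    unfolding A_def abs_mult using mult_mono[OF ey[of y] k1[of y]] by simp
  have kl: "\<bar>max 0 (1 - norm x) - max 0 (1 - norm y)\<bar> \<le> norm (x - y)" for x y :: 'a
    using norm_triangle_ineq3[of x y] by (auto simp: max_def)
  have A1: "\<bar>A x - A y\<bar> \<le> 2 * norm (x - y)" if "norm x \<le> 1" for x y
  proof -
    have "A x - A y = (e \<bullet> x) * (max 0 (1 - norm x) - max 0 (1 - norm y)) + (e \<bullet> (x - y)) * max 0 (1 - norm y)"
      by (simp add: A_def algebra_simps)
    also have "\<bar>\<dots>\<bar> \<le> 1 * norm (x - y) + norm (x - y) * 1"
      by (rule order_trans[OF abs_triangle_ineq], unfold abs_mult)
         (intro add_mono mult_mono kl k1 ey order_trans[OF ey that], auto)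
    finally show ?thesis by simp
  qed
  have A2: "\<bar>A x - A y\<bar> \<le> 2 * norm (x - y)" for x y
  proof (cases "norm x \<le> 1")
    case False
    show ?thesis
    proof (cases "norm y \<le> 1")
      case True
      then show ?thesis using A1[of y x] by (simp add: norm_minus_commute abs_minus_commute)
    qed (use False in \<open>simp add: A_def\<close>)
  qed (rule A1)
  have \<psi>A: "\<psi> y = A y * F y" for y by (simp add: \<psi>_def A_def)
  have z: "\<bar>A y * F y\<bar> \<le> (K + 2 * B) * norm y" for y
  proof -
    have "\<bar>A y * F y\<bar> \<le> norm y * B" unfolding abs_mult by (intro mult_mono A_le F) auto
    also have "\<dots> \<le> norm y * (K + 2 * B)" using B K by (intro mult_left_mono) auto
    finally show ?thesis by (simp add: mult.commute)
  qed
  consider "x = 0" | "y = 0" | "x \<noteq> 0" "y \<noteq> 0" by blast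
  then show ?thesis
  proof cases
    case 1 then show ?thesis using z[of y] by (simp add: \<psi>A A_def)
  next
    case 2 then show ?thesis using z[of x] by (simp add: \<psi>A A_def)
  next
    case 3
    have "\<psi> x - \<psi> y = A x * (F x - F y) + (A x - A y) * F y" by (simp add: \<psi>A algebra_simps)
    also have "\<bar>\<dots>\<bar> \<le> norm x * \<bar>F x - F y\<bar> + (2 * norm (x - y)) * B"
      by (rule order_trans[OF abs_triangle_ineq], unfold abs_mult)
         (intro add_mono mult_mono A_le A2 F, auto)
    also have "\<dots> \<le> K * norm (x - y) + (2 * norm (x - y)) * B" using lip[OF 3] by simp
    finally show ?thesis by (simp add: algebra_simps)
  qed
qed

lemma powr_lipschitz:
  fixes a b m p :: real
  assumes "0 < m" "m \<le> a" "m \<le> b" "p \<le> 1"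
  shows "\<bar>a powr p - b powr p\<bar> \<le> \<bar>p\<bar> * m powr (p - 1) * \<bar>a - b\<bar>"
proof -
  have *: "\<bar>a powr p - b powr p\<bar> \<le> \<bar>p\<bar> * m powr (p - 1) * \<bar>a - b\<bar>" if "m \<le> a" "a < b" for a b
  proof -
    have "((\<lambda>z. z powr p) has_real_derivative p * x powr (p - 1)) (at x)" if "a \<le> x" for x
      using that \<open>m \<le> a\<close> assms(1) by (intro has_real_derivative_powr) auto
    then obtain z where z: "a < z" "z < b" "b powr p - a powr p = (b - a) * (p * z powr (p - 1))"
      using MVT2[OF \<open>a < b\<close>, of "\<lambda>z. z powr p" "\<lambda>z. p * z powr (p - 1)"] by auto
    have "\<bar>b powr p - a powr p\<bar> = \<bar>p\<bar> * z powr (p - 1) * \<bar>a - b\<bar>"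
      using z that by (simp add: abs_mult)
    also have "\<dots> \<le> \<bar>p\<bar> * m powr (p - 1) * \<bar>a - b\<bar>"
      using z that assms by (intro mult_right_mono mult_left_mono powr_mono2') auto
    finally show ?thesis by (simp add: abs_minus_commute)
  qed
  consider "a = b" | "a < b" | "b < a" by linarith
  then show ?thesis
  proof cases
    case 3 then show ?thesis using *[of b a] assms by (simp add: abs_minus_commute)
  qed (use * assms in auto)
qed

text \<open>The equation enters as the choice of the density. At y = 0 we have
  \<open>sgn y = 0\<close> and \<open>H 0 = 0\<close>, and \<open>0 powr _ = 0\<close>, so
  identities such as \<open>h_at_mult\<close> hold there too.\<close>

locale solution_body =
  support_function_with_density H G G' "\<lambda>y. H (sgn y) powr (p - 1)" m M
  for H :: "real^'m::finite \<Rightarrow> real" and G G' p m M +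
  assumes p_neg: "p < 0"
begin

abbreviation (input) h_at where "h_at y \<equiv> H (sgn y)"

lemma h_at_bounds: "y \<noteq> 0 \<Longrightarrow> m \<le> h_at y" "y \<noteq> 0 \<Longrightarrow> h_at y \<le> M" "y \<noteq> 0 \<Longrightarrow> 0 < h_at y"
  using H_ge[of "sgn y"] H_le[of "sgn y"] m_pos by (auto simp: norm_sgn)

lemma h_at_mult: "h_at y * h_at y powr (p - 1) = h_at y powr p"
  using h_at_bounds(3)[of y] powr_mult_base[of "h_at y" "p - 1"] by (cases "y = 0") auto

lemma bounded_borel_powr: "bounded_borel (\<lambda>y. h_at y powr p)"
  unfolding h_at_mult[symmetric] by (intro bounded_borel_mult bounded_borel_H bounded_borel_D)

lemma directional_derivative_powr:
  assumes "y \<noteq> 0"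
  shows "((\<lambda>t. h_at (y + t *\<^sub>R e) powr p) has_real_derivative
    p * h_at y powr (p - 1) * (e \<bullet> G y - h_at y * (e \<bullet> sgn y)) / norm y) (at 0)"
proof -
  have 1: "((\<lambda>t. y + t *\<^sub>R e) has_derivative (\<lambda>h. h *\<^sub>R e)) (at 0)"
    by (auto intro!: derivative_eq_intros)
  have "(H has_derivative (\<lambda>u. G y \<bullet> u)) (at (y + 0 *\<^sub>R e))" using H_deriv[OF assms] by simp
  from diff_chain_at[OF 1 this]
  have H1: "((\<lambda>t. H (y + t *\<^sub>R e)) has_real_derivative e \<bullet> G y) (at 0)"
    by (simp add: has_field_derivative_def o_def inner_commute mult_commute_abs)
  have "(norm has_derivative (\<lambda>u. u \<bullet> sgn y)) (at (y + 0 *\<^sub>R e))"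
    using has_derivative_norm[OF assms] by simp
  from diff_chain_at[OF 1 this]
  have n1: "((\<lambda>t. norm (y + t *\<^sub>R e)) has_real_derivative e \<bullet> sgn y) (at 0)"
    by (simp add: has_field_derivative_def o_def inner_commute mult_commute_abs)
  have f: "H y = norm y * h_at y" by (rule H_sgn)
  have "((\<lambda>t. H (y + t *\<^sub>R e) / norm (y + t *\<^sub>R e)) has_real_derivative
      ((e \<bullet> G y) * norm y - H y * (e \<bullet> sgn y)) / (norm y * norm y)) (at 0)"
    using DERIV_divide[OF H1 n1] assms by simp
  then have "((\<lambda>t. H (y + t *\<^sub>R e) / norm (y + t *\<^sub>R e)) has_real_derivative
      (e \<bullet> G y - h_at y * (e \<bullet> sgn y)) / norm y) (at 0)"
    by (rule DERIV_cong) (use assms in \<open>simp add: f field_simps\<close>)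
  moreover have "0 < H (y + 0 *\<^sub>R e) / norm (y + 0 *\<^sub>R e)" using assms H_pos by simp
  ultimately have "((\<lambda>t. (H (y + t *\<^sub>R e) / norm (y + t *\<^sub>R e)) powr p) has_real_derivative
      p * (H (y + 0 *\<^sub>R e) / norm (y + 0 *\<^sub>R e)) powr (p - 1) * ((e \<bullet> G y - h_at y * (e \<bullet> sgn y)) / norm y)) (at 0)"
    by (rule DERIV_fun_powr[where r=p, unfolded of_nat_1])
  moreover have "H z / norm z = h_at z" for z
    using H_sgn[of z] by (cases "z = 0") auto
  ultimately show ?thesis by simp
qed

text \<open>The variation of \<open>\<integral> h\<^sup>p\<close> under \<open>x \<mapsto> x + t (e \<bullet> x) e\<close>, obtained by integrating the
  \<open>e\<close>-derivative of \<open>(e \<bullet> y) max 0 (1 - |y|) h(y/|y|)\<^sup>p\<close>.\<close>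

lemma integral_stretch_identity:
  assumes e: "norm e = 1"
  shows "(LINT y:punctured_ball|lborel. (1 - norm y) * (h_at y powr p
      + p * ((e \<bullet> G y) * ((e \<bullet> sgn y) * h_at y powr (p - 1))) - p * ((e \<bullet> sgn y)\<^sup>2 * h_at y powr p)))
    = (LINT y:punctured_ball|lborel. norm y * ((e \<bullet> sgn y)\<^sup>2 * h_at y powr p))"
proof -
  define \<psi> where "\<psi> y = (e \<bullet> y) * max 0 (1 - norm y) * h_at y powr p" for y
  \<comment> \<open>\<open>q1\<close> collects the terms that keep the cut-off
    \<open>1 - norm y\<close>; \<open>q2\<close> comes from differentiating the cut-off.\<close>
  define q1 where "q1 y = h_at y powr p + p * ((e \<bullet> G y) * ((e \<bullet> sgn y) * h_at y powr (p - 1)))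
    - p * ((e \<bullet> sgn y)\<^sup>2 * h_at y powr p)" for y
  define q2 where "q2 y = (e \<bullet> sgn y)\<^sup>2 * h_at y powr p" for y
  define d where "d y = indicator punctured_ball y * ((1 - norm y) * q1 y - norm y * q2 y)" for y
  have bq1: "bounded_borel q1" and bq2: "bounded_borel q2"
    unfolding q1_def q2_def power2_eq_square
      by (intro bounded_borel_intros bounded_borel_powr bounded_borel_G bounded_borel_D)+
  have [measurable]: "q1 \<in> borel_measurable borel" "q2 \<in> borel_measurable borel"
    using bq1 bq2 by (auto simp: bounded_borel_def)
  have Fle: "\<bar>h_at x powr p\<bar> \<le> m powr p" for x
    using h_at_bounds(1)[of x] p_neg m_pos by (cases "x = 0") (auto intro: powr_mono2')
  have Flip: "norm x * \<bar>h_at x powr p - h_at y powr p\<bar> \<le> 2 * (\<bar>p\<bar> * m powr (p - 1) * M) * norm (x - y)"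
    if "x \<noteq> 0" "y \<noteq> 0" for x y
  proof -
    have M: "0 \<le> M" using h_at_bounds[OF that(1)] by linarith
    have "\<bar>h_at x powr p - h_at y powr p\<bar> \<le> \<bar>p\<bar> * m powr (p - 1) * \<bar>h_at x - h_at y\<bar>"
      using p_neg by (intro powr_lipschitz m_pos h_at_bounds that) auto
    also have "\<dots> \<le> \<bar>p\<bar> * m powr (p - 1) * (M * norm (sgn x - sgn y))"
      by (intro mult_left_mono H_lipschitz H_le) auto
    finally have "norm x * \<bar>h_at x powr p - h_at y powr p\<bar> \<le> norm x * (\<bar>p\<bar> * m powr (p - 1) * (M * norm (sgn x - sgn y)))"
      by (intro mult_left_mono) auto
    also have "\<dots> = (\<bar>p\<bar> * m powr (p - 1) * M) * (norm x * norm (sgn x - sgn y))" by simp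
    also have "\<dots> \<le> (\<bar>p\<bar> * m powr (p - 1) * M) * (2 * norm (x - y))"
      using M by (intro mult_left_mono norm_sgn_diff_le) auto
    finally show ?thesis by simp
  qed
  have "(\<integral>y. d y \<partial>lborel) = 0"
  proof (rule integral_directional_derivative_eq_0)
    show "\<bar>\<psi> x - \<psi> y\<bar> \<le> (2 * (\<bar>p\<bar> * m powr (p - 1) * M) + 2 * m powr p) * norm (x - y)" for x y
      unfolding \<psi>_def by (rule lipschitz_cone_mult[OF e Fle Flip])
    show "\<psi> y = 0" if "norm y \<ge> 1" for y using that by (simp add: \<psi>_def)
    have [measurable]: "punctured_ball \<in> sets (borel :: (real^'m) measure)"
      by (rule borel_punctured_ball)
    show "d \<in> borel_measurable borel" unfolding d_def[abs_def] by measurable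
    show "AE y in lborel. ((\<lambda>t. \<psi> (y + t *\<^sub>R e)) has_real_derivative d y) (at 0)"
      using AE_norm_neq_1 AE_lborel_singleton[of 0]
    proof eventually_elim
      case (elim y)
      have line: "((\<lambda>t. norm (y + t *\<^sub>R e)) \<longlongrightarrow> norm y) (at 0)"
        by (auto intro!: tendsto_eq_intros)
      show ?case
      proof (cases "norm y < 1")
        case False
        then have "1 < norm y" using elim by simp
        then have "\<forall>\<^sub>F t in at 0. 1 < norm (y + t *\<^sub>R e)"
          using line by (rule order_tendstoD(1)[rotated])
        then have "\<forall>\<^sub>F t in at 0. \<psi> (y + t *\<^sub>R e) = 0" by eventually_elim (simp add: \<psi>_def)
        moreover have "\<psi> (y + 0 *\<^sub>R e) = 0" using False by (simp add: \<psi>_def)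
        ultimately have "\<forall>\<^sub>F t in nhds 0. \<psi> (y + t *\<^sub>R e) = 0"
          by (simp add: eventually_nhds_conv_at)
        then have "((\<lambda>t. \<psi> (y + t *\<^sub>R e)) has_real_derivative 0) (at 0) \<longleftrightarrow> ((\<lambda>t::real. 0::real) has_real_derivative 0) (at 0)"
          by (intro DERIV_cong_ev) auto
        moreover have "d y = 0" using \<open>1 < norm y\<close> by (simp add: d_def)
        ultimately show ?thesis by simp
      next
        case True
        then have "\<forall>\<^sub>F t in at 0. norm (y + t *\<^sub>R e) < 1"
          using line by (rule order_tendstoD(2)[rotated])
        then have ev: "\<forall>\<^sub>F t in nhds 0. norm (y + t *\<^sub>R e) < 1"
          using True by (simp add: eventually_nhds_conv_at)
        let ?\<phi> = "\<lambda>t. (e \<bullet> y + t) * (1 - norm (y + t *\<^sub>R e)) * h_at (y + t *\<^sub>R e) powr p"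
        have ee: "e \<bullet> e = 1" using e by (simp add: norm_eq_1)
        have "\<forall>\<^sub>F t in nhds 0. \<psi> (y + t *\<^sub>R e) = ?\<phi> t"
          using ev by eventually_elim (simp add: \<psi>_def inner_add_right ee)
        then have eq: "((\<lambda>t. \<psi> (y + t *\<^sub>R e)) has_real_derivative d y) (at 0) \<longleftrightarrow> (?\<phi> has_real_derivative d y) (at 0)"
          by (intro DERIV_cong_ev) auto
        have n1: "((\<lambda>t. norm (y + t *\<^sub>R e)) has_real_derivative e \<bullet> sgn y) (at 0)"
        proof -
          have 1: "((\<lambda>t. y + t *\<^sub>R e) has_derivative (\<lambda>h. h *\<^sub>R e)) (at 0)"
            by (auto intro!: derivative_eq_intros)
          have "(norm has_derivative (\<lambda>u. u \<bullet> sgn y)) (at (y + 0 *\<^sub>R e))"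
            using has_derivative_norm elim by simp
          from diff_chain_at[OF 1 this] show ?thesis
            by (simp add: has_field_derivative_def o_def inner_commute mult_commute_abs)
        qed
        have ey: "e \<bullet> y = norm y * (e \<bullet> sgn y)" using elim by (simp add: sgn_div_norm)
        have "((\<lambda>t. (e \<bullet> y + t) * (1 - norm (y + t *\<^sub>R e))) has_real_derivative
            (1 - norm y) - (e \<bullet> y) * (e \<bullet> sgn y)) (at 0)"
          by (auto intro!: derivative_eq_intros n1)
        from DERIV_mult[OF this directional_derivative_powr, of y e] elim
        have "(?\<phi> has_real_derivative ((1 - norm y) - (e \<bullet> y) * (e \<bullet> sgn y)) * h_at y powr p
           + (p * h_at y powr (p - 1) * (e \<bullet> G y - h_at y * (e \<bullet> sgn y)) / norm y) * ((e \<bullet> y) * (1 - norm y))) (at 0)"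
          by simp
        moreover have "((1 - norm y) - (e \<bullet> y) * (e \<bullet> sgn y)) * h_at y powr p
           + (p * h_at y powr (p - 1) * (e \<bullet> G y - h_at y * (e \<bullet> sgn y)) / norm y) * ((e \<bullet> y) * (1 - norm y)) = d y"
          using True elim unfolding d_def q1_def q2_def ey
          by (simp add: h_at_mult[symmetric] power2_eq_square field_simps)
        ultimately show ?thesis unfolding eq by simp
      qed
    qed
  qed (rule e)
  also have "(\<integral>y. d y \<partial>lborel) = (LINT y:punctured_ball|lborel. (1 - norm y) * q1 y - norm y * q2 y)"
    unfolding d_def set_lebesgue_integral_def by simp
  also have "\<dots> = (LINT y:punctured_ball|lborel. (1 - norm y) * q1 y) - (LINT y:punctured_ball|lborel. norm y * q2 y)"
    by (intro set_integral_diff set_integrable_punctured_ball bounded_borel_intros bq1 bq2)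
  finally show ?thesis unfolding q1_def q2_def by simp
qed

text \<open>Let J denote integration against \<open>1 - norm y\<close>. Integration by parts gives J
  F + p J g = (N + p) J q, the first moment gives N J g = J F; eliminating J g leaves (N + p) N J q
  = (N + p) J F.\<close>

lemma integral_isotropic:
  assumes e: "norm e = 1" and p: "p \<noteq> - real CARD('m)"
  shows "(LINT y:punctured_ball|lborel. (e \<bullet> sgn y)\<^sup>2 * h_at y powr p)
    = (LINT y:punctured_ball|lborel. h_at y powr p) / CARD('m)"
proof -
  let ?N = "real CARD('m)"
  let ?J = "\<lambda>q. LINT y:punctured_ball|lborel. (1 - norm y) * q y"
  define F where "F y = h_at y powr p" for y
  define g where "g y = (e \<bullet> G y) * ((e \<bullet> sgn y) * h_at y powr (p - 1))" for y
  define q where "q y = (e \<bullet> sgn y)\<^sup>2 * h_at y powr p" for y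
  have bb: "bounded_borel F" "bounded_borel g" "bounded_borel q"
    unfolding F_def g_def q_def power2_eq_square
      by (intro bounded_borel_intros bounded_borel_powr bounded_borel_G bounded_borel_D)+
  have sg: "sgn (c *\<^sub>R y) = sgn y" if "c > 0" for c and y :: "real^'m"
    using that by (simp add: sgn_scaleR)
  have hom: "F (c *\<^sub>R y) = F y" "g (c *\<^sub>R y) = g y" "q (c *\<^sub>R y) = q y" if "c > 0" for c y
    using that by (simp_all add: F_def g_def q_def sg G_scale)
  have lin: "?J (\<lambda>y. a y + b y) = ?J a + ?J b" if "bounded_borel a" "bounded_borel b" for a b
    unfolding distrib_left
    by (intro set_integral_add set_integrable_punctured_ball bounded_borel_intros that)
  have cm: "?J (\<lambda>y. c * a y) = c * ?J a" for c a
  proof -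
    have "?J (\<lambda>y. c * a y) = (LINT y:punctured_ball|lborel. c * ((1 - norm y) * a y))"
      by (simp add: mult.left_commute)
    then show ?thesis by (simp only: set_integral_mult_right)
  qed
  have "?J (\<lambda>y. F y + p * g y - p * q y) = (LINT y:punctured_ball|lborel. norm y * q y)"
    using integral_stretch_identity[OF e] unfolding F_def g_def q_def .
  also have "\<dots> = ?N * ?J q" using integral_norm_mult_radial[OF bb(3) hom(3)] by simp
  finally have 1: "?J F + p * ?J g - p * ?J q = ?N * ?J q"
  proof -
    assume a: "?J (\<lambda>y. F y + p * g y - p * q y) = ?N * ?J q"
    have "?J (\<lambda>y. F y + p * g y - p * q y) = ?J (\<lambda>y. (F y + p * g y) + (- p) * q y)" by simp
    also have "\<dots> = ?J (\<lambda>y. F y + p * g y) + ?J (\<lambda>y. (- p) * q y)"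
      by (intro lin bounded_borel_intros bb)
    also have "\<dots> = (?J F + ?J (\<lambda>y. p * g y)) + ?J (\<lambda>y. (- p) * q y)"
      using lin[of F "\<lambda>y. p * g y"] bb by (simp add: bounded_borel_intros)
    finally show ?thesis using a unfolding cm by simp
  qed
  have "(LINT y:punctured_ball|lborel. norm y * (F y + g y)) = (LINT y:punctured_ball|lborel. F y)"
    using integral_first_moment[OF e] unfolding F_def g_def h_at_mult .
  moreover have "(LINT y:punctured_ball|lborel. norm y * (F y + g y)) = ?N * ?J (\<lambda>y. F y + g y)"
    using integral_norm_mult_radial[OF bounded_borel_add[OF bb(1,2)]] hom by simp
  moreover have "?J (\<lambda>y. F y + g y) = ?J F + ?J g" by (intro lin bb)
  moreover have IF: "(LINT y:punctured_ball|lborel. F y) = (?N + 1) * ?J F"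
    using integral_radial[OF bb(1) hom(1)] by simp
  ultimately have 2: "?N * ?J g = ?J F" by (simp add: algebra_simps)
  have "(?N + p) * (?N * ?J q) = (?N + p) * ?J F"
  proof -
    have "(?N + p) * (?N * ?J q) = ?N * (?N * ?J q) + ?N * (p * ?J q)" by (simp add: algebra_simps)
    also have "\<dots> = ?N * (?J F + p * ?J g)" using 1 by (simp add: algebra_simps)
    also have "\<dots> = (?N + p) * ?J F" using 2 by (simp add: algebra_simps)
    finally show ?thesis .
  qed
  then have "?N * ?J q = ?J F" using p by auto
  moreover have "(LINT y:punctured_ball|lborel. q y) = (?N + 1) * ?J q"
    using integral_radial[OF bb(3) hom(3)] by simp
  ultimately have "?N * (LINT y:punctured_ball|lborel. q y) = (LINT y:punctured_ball|lborel. F y)"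
    unfolding IF by (simp add: algebra_simps)
  then show ?thesis unfolding F_def q_def by (simp add: field_simps)
qed

end

section \<open>The bound on the ratio of maximum and minimum\<close>

lemma set_integral_const_lborel:
  assumes "S \<in> sets borel" "bounded S"
  shows "(LINT y:S|lborel. c) = c * measure lborel (S :: 'a::euclidean_space set)"
proof -
  have "emeasure lborel S < \<infinity>" using assms(2) by (rule emeasure_bounded_finite)
  then show ?thesis using assms(1) by (simp add: set_lebesgue_integral_def)
qed

lemma integral_const_punctured_ball:
  "(LINT y:(punctured_ball :: 'a::euclidean_space set)|lborel. c) = c * unit_ball_vol DIM('a)"
  for c :: real
proof -
  have "(LINT y:(punctured_ball :: 'a set)|lborel. c) = (LINT y:cball (0::'a) 1|lborel. c)"
  proof (rule set_integral_cong_negligible_diff)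
    show "AE y in lborel. indicator punctured_ball (y::'a) * c = indicator (cball 0 1) y * c"
      using AE_lborel_singleton[of 0] by eventually_elim (auto simp: indicator_def)
  qed auto
  also have "\<dots> = c * unit_ball_vol DIM('a)"
    by (subst set_integral_const_lborel) (auto simp: content_cball)
  finally show ?thesis .
qed

text \<open>The linear term \<open>s f\<^sup>p\<^sup>-\<^sup>1\<close> integrates to zero, so integrating this bound shows that the mass of
  \<open>f\<^sup>p\<close> cannot concentrate where \<open>f\<close> is small compared with \<open>M\<close>.\<close>

lemma square_mult_powr_le:
  fixes f s M \<delta> p :: real
  assumes "0 < f" "M * s \<le> f" "\<bar>s\<bar> \<le> 1" "p < 0" "0 < \<delta>" "\<delta> \<le> 1" "0 < M"
  shows "s\<^sup>2 * f powr p \<le> - (\<delta> * M) * (s * f powr (p - 1)) + 2 * \<delta> * f powr p + (\<delta> * M) powr p"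
proof -
  have f: "f * f powr (p - 1) = f powr p" using assms(1) powr_mult_base[of f "p - 1"] by simp
  have s2: "s\<^sup>2 \<le> \<bar>s\<bar>"
    using assms(3) by (metis abs_ge_zero mult_left_le power2_abs power2_eq_square)
  \<comment> \<open>The linear term costs at most one \<delta> f^p; the second one in the bound is
    for the case 0 < s.\<close>
  have lin: "- \<delta> * f powr p \<le> - (\<delta> * M) * (s * f powr (p - 1))"
  proof -
    have "M * s * (\<delta> * f powr (p - 1)) \<le> f * (\<delta> * f powr (p - 1))"
      using assms by (intro mult_right_mono) auto
    then show ?thesis by (simp add: f[symmetric] mult_ac)
  qed
  show ?thesis
  proof (cases "f \<le> \<delta> * M")
    case True
    \<comment> \<open>For s \<le> 0 the linear term is nonnegative and suffices alone; for 0 < s,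
      \<open>M * s \<le> f \<le> \<delta> * M\<close> makes s at most \<delta>.\<close>
    show ?thesis
    proof (cases "s \<le> 0")
      case neg: True
      have "s\<^sup>2 * f powr p \<le> \<bar>s\<bar> * (f * f powr (p - 1))"
        unfolding f using s2 by (intro mult_right_mono) auto
      also have "\<dots> \<le> \<bar>s\<bar> * ((\<delta> * M) * f powr (p - 1))"
        using True by (intro mult_left_mono mult_right_mono) auto
      also have "\<dots> = - (\<delta> * M) * (s * f powr (p - 1))" using neg by simp
      finally have a: "s\<^sup>2 * f powr p \<le> - (\<delta> * M) * (s * f powr (p - 1))" .
      have "0 \<le> 2 * \<delta> * f powr p" "0 \<le> (\<delta> * M) powr p" using assms by auto
      with a show ?thesis by linarith
    next
      case False
      have "M * s \<le> M * \<delta>" using True assms(2) by (simp add: mult.commute)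
      then have "s \<le> \<delta>" using assms by simp
      then have "s\<^sup>2 * f powr p \<le> \<delta> * f powr p" using s2 False by (intro mult_right_mono) auto
      moreover have "0 \<le> (\<delta> * M) powr p" by simp
      ultimately show ?thesis using lin by (simp only:)
    qed
  next
    case False
    have "s\<^sup>2 * f powr p \<le> 1 * f powr p" using s2 assms by (intro mult_right_mono) auto
    also have "\<dots> \<le> (\<delta> * M) powr p" using False assms by (simp add: powr_mono2')
    finally have a: "s\<^sup>2 * f powr p \<le> (\<delta> * M) powr p" .
    have "0 \<le> \<delta> * f powr p" using assms by simp
    with a lin show ?thesis by (simp only:)
  qed
qed

context solution_body
begin

lemma integral_powr_eq_volume: "(LINT y:punctured_ball|lborel. h_at y powr p) = measure lborel body"
  using volume_body_eq set_integral_const_lborel[OF borel_body bounded_body, of 1]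
    by (simp add: h_at_mult)

lemma M_pos: "0 < M"
proof -
  obtain x :: "real^'m" where "norm x = 1" using vector_choose_size[of 1] by auto
  then show ?thesis using H_ge H_le m_pos by force
qed

text \<open>If M < 1, then h^p > 1 makes the volume exceed that of the unit ball, although the body
  lies in the ball of radius M.\<close>

lemma M_ge_1: "1 \<le> M"
proof (rule ccontr)
  assume "\<not> 1 \<le> M"
  let ?\<kappa> = "unit_ball_vol (real CARD('m))"
  have "M powr p * ?\<kappa> = (LINT y:(punctured_ball :: (real^'m) set)|lborel. M powr p)"
    using integral_const_punctured_ball[of "M powr p", where 'a="real^'m"] by simp
  also have "\<dots> \<le> (LINT y:punctured_ball|lborel. h_at y powr p)"
  proof (intro set_integral_mono set_integrable_punctured_ball bounded_borel_const bounded_borel_powr)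
    show "M powr p \<le> h_at y powr p" if "y \<in> punctured_ball" for y
      using that h_at_bounds[of y] p_neg by (intro powr_mono2') auto
  qed
  also have "\<dots> \<le> measure lborel (cball (0::real^'m) M)"
    unfolding integral_powr_eq_volume using body_bounds(2)[OF _ H_ge H_le] m_pos borel_body
    by (intro measure_mono_fmeasurable) (auto intro: fmeasurable_cbox fmeasurable_compact)
  also have "\<dots> = M ^ CARD('m) * ?\<kappa>" using M_pos by (simp add: content_cball)
  finally have "M powr p \<le> M ^ CARD('m)" by simp
  moreover have "1 < M powr p" using \<open>\<not> 1 \<le> M\<close> M_pos p_neg powr_less_mono2_neg[of p M 1] by simp
  moreover have "M ^ CARD('m) \<le> 1" using \<open>\<not> 1 \<le> M\<close> M_pos by (intro power_le_one) auto
  ultimately show False by linarith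
qed

text \<open>Mirror image of \<open>M_ge_1\<close>: a body containing a ball of radius above 1 would
  have less volume than the unit ball.\<close>

lemma m_le_1: "m \<le> 1"
proof (rule ccontr)
  assume "\<not> m \<le> 1"
  let ?\<kappa> = "unit_ball_vol (real CARD('m))"
  have "m ^ CARD('m) * ?\<kappa> = measure lborel (cball (0::real^'m) m)"
    using m_pos by (simp add: content_cball)
  also have "\<dots> \<le> (LINT y:punctured_ball|lborel. h_at y powr p)"
    unfolding integral_powr_eq_volume
      using body_bounds(1)[OF _ H_ge H_le] m_pos bounded_body closed_body
    by (intro measure_mono_fmeasurable) (auto intro!: fmeasurable_compact simp: compact_eq_bounded_closed)
  also have "\<dots> \<le> (LINT y:(punctured_ball :: (real^'m) set)|lborel. m powr p)"
  proof (intro set_integral_mono set_integrable_punctured_ball bounded_borel_const bounded_borel_powr)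
    show "h_at y powr p \<le> m powr p" if "y \<in> punctured_ball" for y
      using that h_at_bounds[of y] p_neg m_pos by (intro powr_mono2') auto
  qed
  also have "\<dots> = m powr p * ?\<kappa>"
    using integral_const_punctured_ball[of "m powr p", where 'a="real^'m"] by simp
  finally have "m ^ CARD('m) \<le> m powr p" by simp
  moreover have "m powr p < 1" using \<open>\<not> m \<le> 1\<close> p_neg powr_less_mono2_neg[of p 1 m] by simp
  moreover have "1 \<le> m ^ CARD('m)" using \<open>\<not> m \<le> 1\<close> by (intro one_le_power) auto
  ultimately show False by linarith
qed

text \<open>The integral \<open>A\<close> of h^p is bounded above through isotropy in the direction
  of the maximum, and below by its part near the minimum point. The powers of M cancel between the
  two bounds.\<close>

lemma ratio_bound:
  assumes x0: "norm x0 = 1" "H x0 = M" and x1: "norm x1 = 1" "H x1 = m"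
    and p: "p \<noteq> - real CARD('m)"
  shows "(m / M) powr (p + real CARD('m)) \<le> 2 * real CARD('m) * 4 ^ CARD('m) * (12 * real CARD('m)) powr (- p)"
proof -
  let ?N = "real CARD('m)"
  let ?I = "\<lambda>q. LINT y:(punctured_ball :: (real^'m) set)|lborel. q y"
  let ?\<kappa> = "unit_ball_vol ?N"
  \<comment> \<open>Chosen so that \<open>2 * \<delta> * A\<close> is half of \<open>A / ?N\<close>
    and can be absorbed.\<close>
  define \<delta> where "\<delta> = 1 / (4 * ?N)"
  have N: "1 \<le> ?N" by (simp add: Suc_leI)
  have "1 \<le> 4 * ?N" using N by linarith
  then have \<delta>: "0 < \<delta>" "\<delta> \<le> 1" by (simp_all add: \<delta>_def)
  have \<kappa>: "0 < ?\<kappa>" by simp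
  define A where "A = ?I (\<lambda>y. h_at y powr p)"
  \<comment> \<open>\<open>M *\<^sub>R x0\<close> belongs to the body:
    \<open>norm (G x0) \<le> M\<close> and \<open>G x0 \<bullet> x0 = M\<close> leave only
    \<open>G x0 = M *\<^sub>R x0\<close>.\<close>
  have supp: "M * (x0 \<bullet> z) \<le> H z" for z
  proof -
    have "x0 \<noteq> 0" using x0 by auto
    have "norm (G x0) \<le> M" by (rule norm_G_le[OF H_le \<open>x0 \<noteq> 0\<close>])
    then have "G x0 \<bullet> G x0 \<le> M\<^sup>2" by (metis norm_ge_zero power2_norm_eq_inner power_mono)
    moreover have "G x0 \<bullet> x0 = M" using G_inner_self[OF \<open>x0 \<noteq> 0\<close>] x0 by simp
    moreover have "x0 \<bullet> x0 = 1" using x0 by (simp add: norm_eq_1)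
    ultimately have "(G x0 - M *\<^sub>R x0) \<bullet> (G x0 - M *\<^sub>R x0) \<le> 0"
      by (simp add: inner_diff_left inner_diff_right inner_commute power2_eq_square)
    then have "(G x0 - M *\<^sub>R x0) \<bullet> (G x0 - M *\<^sub>R x0) = 0" by (intro antisym inner_ge_zero)
    then have "G x0 = M *\<^sub>R x0" by simp
    then show ?thesis using G_inner_le[OF \<open>x0 \<noteq> 0\<close>, of z] by simp
  qed
  have up: "A / (2 * ?N) \<le> (\<delta> * M) powr p * ?\<kappa>"
  proof -
    have bb: "bounded_borel (\<lambda>y. (x0 \<bullet> sgn y)\<^sup>2 * h_at y powr p)"
        "bounded_borel (\<lambda>y. - (\<delta> * M) * ((x0 \<bullet> sgn y) * h_at y powr (p - 1)))"
        "bounded_borel (\<lambda>y. 2 * \<delta> * h_at y powr p)"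
      unfolding power2_eq_square by (intro bounded_borel_intros bounded_borel_powr bounded_borel_D)+
    have "A / ?N = ?I (\<lambda>y. (x0 \<bullet> sgn y)\<^sup>2 * h_at y powr p)"
      unfolding A_def using integral_isotropic[OF x0(1) p] by simp
    also have "\<dots> \<le> ?I (\<lambda>y. - (\<delta> * M) * ((x0 \<bullet> sgn y) * h_at y powr (p - 1)) + 2 * \<delta> * h_at y powr p + (\<delta> * M) powr p)"
    proof (intro set_integral_mono set_integrable_punctured_ball bb bounded_borel_add bounded_borel_const)
      fix y :: "real^'m" assume "y \<in> punctured_ball"
      then have y: "y \<noteq> 0" by simp
      have "\<bar>x0 \<bullet> sgn y\<bar> \<le> 1" using Cauchy_Schwarz_ineq2[of x0 "sgn y"] x0 y by (simp add: norm_sgn)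
      then show "(x0 \<bullet> sgn y)\<^sup>2 * h_at y powr p \<le>
          - (\<delta> * M) * ((x0 \<bullet> sgn y) * h_at y powr (p - 1)) + 2 * \<delta> * h_at y powr p + (\<delta> * M) powr p"
        by (intro square_mult_powr_le supp h_at_bounds y p_neg \<delta> M_pos)
    qed
    also have "\<dots> = ?I (\<lambda>y. - (\<delta> * M) * ((x0 \<bullet> sgn y) * h_at y powr (p - 1)) + 2 * \<delta> * h_at y powr p) + ?I (\<lambda>y. (\<delta> * M) powr p)"
      by (intro set_integral_add set_integrable_punctured_ball bb bounded_borel_add bounded_borel_const)
    also have "?I (\<lambda>y. - (\<delta> * M) * ((x0 \<bullet> sgn y) * h_at y powr (p - 1)) + 2 * \<delta> * h_at y powr p)
        = ?I (\<lambda>y. - (\<delta> * M) * ((x0 \<bullet> sgn y) * h_at y powr (p - 1))) + ?I (\<lambda>y. 2 * \<delta> * h_at y powr p)"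
      by (intro set_integral_add set_integrable_punctured_ball bb)
    also have "?I (\<lambda>y. - (\<delta> * M) * ((x0 \<bullet> sgn y) * h_at y powr (p - 1))) = 0"
      unfolding set_integral_mult_right integral_inner_density_eq_0 by simp
    also have "?I (\<lambda>y. 2 * \<delta> * h_at y powr p) = 2 * \<delta> * A"
      unfolding A_def by (rule set_integral_mult_right)
    also have "?I (\<lambda>y. (\<delta> * M) powr p) = (\<delta> * M) powr p * ?\<kappa>"
      using integral_const_punctured_ball[of "(\<delta> * M) powr p", where 'a="real^'m"] by simp
    finally show ?thesis using N by (simp add: \<delta>_def field_simps)
  qed
  have low: "(3 * m) powr p * (?\<kappa> * (m / (4 * M)) ^ CARD('m)) \<le> A"
  proof -
    \<comment> \<open>The radius \<open>m / (4 * M)\<close> is at most 1/4, so the ball around x1/2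
      keeps |y| between 1/4 and 1; there \<open>H y\<close> is at most m/2 + m/4, and dividing by
      |y| gives \<open>h_at y \<le> 3 * m\<close>.\<close>
    define c where "c = (1 / 2) *\<^sub>R x1"
    define r where "r = m / (4 * M)"
    have mM: "m \<le> M" using H_le[OF x1(1)] x1 by simp
    have r: "0 < r" "r \<le> 1 / 4" using m_pos M_pos mM by (auto simp: r_def field_simps)
    have nc: "norm c = 1 / 2" using x1 by (simp add: c_def)
    have in_ball: "1 / 4 \<le> norm y \<and> norm y \<le> 1 \<and> h_at y \<le> 3 * m" if "y \<in> ball c r" for y
    proof -
      have d: "norm (y - c) \<le> r" using that by (simp add: dist_norm norm_minus_commute)
      have n: "1 / 4 \<le> norm y" "norm y \<le> 1"
        using d r nc norm_triangle_ineq3[of y c] by linarith+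
      have "H y \<le> H c + M * norm (y - c)" using H_lipschitz[OF H_le, of y c] by linarith
      also have "\<dots> \<le> (1 / 2) * m + M * r" using d M_pos x1 by (simp add: c_def H_scale)
      also have "\<dots> = 3 / 4 * m" using M_pos by (simp add: r_def)
      also have "\<dots> \<le> norm y * (3 * m)"
        using n m_pos mult_right_mono[of "1/4" "norm y" "3 * m"] by simp
      finally have "norm y * h_at y \<le> norm y * (3 * m)" by (simp flip: H_sgn)
      moreover have "0 < norm y" using n by linarith
      ultimately show ?thesis using n by (simp only: mult_le_cancel_left_pos)
    qed
    have "(3 * m) powr p * (?\<kappa> * r ^ CARD('m)) = (LINT y:ball c r|lborel. (3 * m) powr p)"
      using r by (subst set_integral_const_lborel) (auto simp: content_ball)
    also have "\<dots> \<le> A"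
      unfolding A_def set_lebesgue_integral_def
    proof (rule integral_mono)
      show "integrable lborel (\<lambda>y. indicator (ball c r) y *\<^sub>R (3 * m) powr p)"
        using set_integrable_lborel_bounded[of "ball c r" "\<lambda>_. (3 * m) powr p" "(3 * m) powr p"]
        by (simp add: set_integrable_def)
      show "integrable lborel (\<lambda>y. indicator punctured_ball y *\<^sub>R h_at y powr p)"
        using set_integrable_punctured_ball[OF bounded_borel_powr] by (simp add: set_integrable_def)
      fix y
      show "indicator (ball c r) y *\<^sub>R (3 * m) powr p \<le> indicator punctured_ball y *\<^sub>R h_at y powr p"
      proof (cases "y \<in> ball c r")
        case True
        then have y: "1 / 4 \<le> norm y" "norm y \<le> 1" "h_at y \<le> 3 * m" using in_ball by auto
        then have "y \<noteq> 0" by auto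
        then have "(3 * m) powr p \<le> h_at y powr p"
          using y h_at_bounds(3) p_neg by (intro powr_mono2') auto
        then show ?thesis using True y \<open>y \<noteq> 0\<close> by simp
      qed simp
    qed
    finally show ?thesis by (simp add: r_def)
  qed
  define \<epsilon> where "\<epsilon> = m / M"
  have \<epsilon>: "0 < \<epsilon>" using m_pos M_pos by (simp add: \<epsilon>_def)
  have m: "m = \<epsilon> * M" using M_pos by (simp add: \<epsilon>_def)
  have "(3 * m) powr p * (?\<kappa> * (m / (4 * M)) ^ CARD('m)) \<le> 2 * ?N * ((\<delta> * M) powr p * ?\<kappa>)"
    using low up N by (simp add: field_simps)
  then have "?\<kappa> * ((3 * m) powr p * (m / (4 * M)) ^ CARD('m)) \<le> ?\<kappa> * (2 * ?N * (\<delta> * M) powr p)"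
    by (simp only: mult_ac)
  then have "(3 * m) powr p * (m / (4 * M)) ^ CARD('m) \<le> 2 * ?N * (\<delta> * M) powr p"
    using \<kappa> by (simp only: mult_le_cancel_left_pos)
  then have "3 powr p * \<epsilon> powr p * M powr p * (\<epsilon> powr ?N / 4 ^ CARD('m)) \<le> 2 * ?N * (\<delta> powr p * M powr p)"
    using \<epsilon> M_pos \<delta> by (simp add: m powr_mult powr_realpow power_divide mult_ac)
  then have "M powr p * (3 powr p * \<epsilon> powr p * (\<epsilon> powr ?N / 4 ^ CARD('m))) \<le> M powr p * (2 * ?N * \<delta> powr p)"
    by (simp only: mult_ac)
  then have "3 powr p * \<epsilon> powr p * (\<epsilon> powr ?N / 4 ^ CARD('m)) \<le> 2 * ?N * \<delta> powr p"
    using M_pos by (simp only: mult_le_cancel_left_pos powr_gt_zero)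
  \<comment> \<open>Origin of the constants: 4^N from the radius \<open>m / (4 * M)\<close>, and 12
    N = 3 * 4 N from \<open>h_at y \<le> 3 * m\<close> and from 1/\<delta>.\<close>
  then have "\<epsilon> powr (p + ?N) \<le> 2 * ?N * 4 ^ CARD('m) * (\<delta> powr p / 3 powr p)"
    by (simp add: powr_add field_simps)
  also have "\<delta> powr p / 3 powr p = (12 * ?N) powr (- p)"
  proof -
    have "\<delta> powr p / 3 powr p = (\<delta> / 3) powr p" using \<delta> by (simp add: powr_divide)
    also have "\<delta> / 3 = inverse (12 * ?N)" using N by (simp add: \<delta>_def field_simps)
    also have "\<dots> powr p = inverse ((12 * ?N) powr p)" by (rule inverse_powr)
    finally show ?thesis by (simp only: powr_minus)
  qed
  finally show ?thesis by (simp add: \<epsilon>_def)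
qed

end

section \<open>Solutions as support functions\<close>

lemma transpose_conjugate_nth:
  fixes Q M :: "real^'m^'m"
  shows "(transpose Q ** (M ** Q)) $ a $ b = column a Q \<bullet> (M *v column b Q)"
  by (simp add: matrix_matrix_mult_def transpose_def column_def inner_vec_def matrix_vector_mult_def)

text \<open>\<open>solutions\<close> quantifies over all frames at \<open>x\<close>, so a frame must
  exist before the equation can be used at \<open>x\<close>. The index \<open>None\<close> is
  reserved for the normal \<open>x\<close>.\<close>

lemma orthonormal_frame_exists:
  fixes x :: "real^('n::finite option)"
  assumes "norm x = 1"
  obtains Q :: "real^('n option)^('n option)" where "orthogonal_matrix Q"
    and "column None Q = x" and "orthonormal_frame_at x (\<lambda>i. column (Some i) Q)"
proof -
  obtain Q :: "real^('n option)^('n option)" where Q: "orthogonal_matrix Q" "Q *v axis None 1 = x"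
    using orthogonal_matrix_exists_basis[OF assms] by metis
  have x: "column None Q = x" using Q(2) by (simp add: matrix_vector_mult_basis)
  have "column a Q \<bullet> column b Q = (if a = b then 1 else 0)" for a b
  proof -
    have "(transpose Q ** Q) $ a $ b = mat 1 $ a $ b"
      using Q(1) by (simp add: orthogonal_matrix_def)
    then show ?thesis by (simp add: matrix_mult_transpose_dot_column mat_def)
  qed
  then have "orthonormal_frame_at x (\<lambda>i. column (Some i) Q)"
    unfolding orthonormal_frame_at_def x[symmetric] by auto
  with Q(1) x show thesis by (rule that)
qed

text \<open>In the basis of columns of \<open>Q\<close> the row of \<open>x\<close> has only its
  diagonal entry, which \<open>det_option_block\<close> splits off.\<close>

lemma det_eq_minor_in_frame:
  fixes L :: "real^('n::finite option) \<Rightarrow> real^('n option)"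
  assumes L: "linear L" and Q: "orthogonal_matrix Q" and x: "column None Q = x"
    and orth: "\<And>j. x \<bullet> L (column (Some j) Q) = 0"
  shows "det (matrix L) = (x \<bullet> L x) * det (\<chi> i j. column (Some i) Q \<bullet> L (column (Some j) Q))"
proof -
  let ?B = "transpose Q ** (matrix L ** Q)"
  have B: "?B $ a $ b = column a Q \<bullet> L (column b Q)" for a b
    unfolding transpose_conjugate_nth using L by (simp add: matrix_vector_mul)
  have "det Q * det Q = 1"
    using Q by (metis det_I det_mul det_transpose orthogonal_matrix_def)
  then have "det (matrix L) = det ?B" by (simp add: det_mul det_transpose)
  also have "\<dots> = ?B $ None $ None * det (\<chi> i j. ?B $ Some i $ Some j)"
    by (rule det_option_block) (simp add: B x orth)
  finally show ?thesis by (simp only: B x)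
qed

lemma vector_eq_sum_frame:
  fixes x u :: "real^('n::finite option)"
  assumes Q: "orthogonal_matrix Q" and x: "column None Q = x" and u: "u \<bullet> x = 0"
  shows "u = (\<Sum>i\<in>UNIV. (u \<bullet> column (Some i) Q) *\<^sub>R column (Some i) Q)"
proof -
  have "u = (Q ** transpose Q) *v u" using Q by (simp add: orthogonal_matrix_def)
  also have "\<dots> = Q *v (transpose Q *v u)" by (rule matrix_vector_mul_assoc[symmetric])
  also have "\<dots> = (\<Sum>a\<in>UNIV. (transpose Q *v u) $ a *\<^sub>R column a Q)"
    unfolding matrix_mult_sum[of Q] scalar_mult_eq_scaleR ..
  also have "\<dots> = (\<Sum>a\<in>UNIV. (u \<bullet> column a Q) *\<^sub>R column a Q)"
    unfolding matrix_vector_mul_component by (simp add: transpose_def column_def inner_commute)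
  also have "\<dots> = (\<Sum>i\<in>UNIV. (u \<bullet> column (Some i) Q) *\<^sub>R column (Some i) Q)"
    using u by (simp add: UNIV_option_conv sum.reindex x)
  finally show ?thesis .
qed

lemma frechet_derivative_eqI: "(f has_derivative f') (at x) \<Longrightarrow> frechet_derivative f (at x) = f'"
  by (rule frechet_derivative_at[symmetric])

section \<open>The homogeneous extension of a function on the sphere\<close>

definition sphere_hom :: "(real^'m::finite \<Rightarrow> real) \<Rightarrow> real^'m \<Rightarrow> real" where
  "sphere_hom h y = norm y * radial_ext h y"

text \<open>On the unit sphere this is h x + grad h, the usual formula for the boundary point with
  normal x.\<close>

definition sphere_hom_grad :: "(real^'m::finite \<Rightarrow> real) \<Rightarrow> real^'m \<Rightarrow> real^'m" where
  "sphere_hom_grad h y = radial_ext h y *\<^sub>R sgn y + radial_ext (sphere_grad h) y"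

lemma radial_ext_scale: "0 < c \<Longrightarrow> radial_ext f (c *\<^sub>R y) = radial_ext f y"
  for y :: "'a::real_normed_vector"
proof -
  assume "0 < c"
  then have "inverse c * inverse (norm y) * c = inverse (norm y)" by (simp add: field_simps)
  with \<open>0 < c\<close> show ?thesis
    by (simp only: radial_ext_def norm_scaleR scaleR_scaleR abs_of_pos inverse_mult_distrib)
qed

lemma radial_ext_unit: "norm x = 1 \<Longrightarrow> radial_ext f x = f x"
  by (simp add: radial_ext_def)

context
  fixes h :: "real^'m::finite \<Rightarrow> real"
  assumes sm: "smooth_on_sphere h"
begin

lemma radial_ext_deriv:
  assumes "y \<noteq> 0"
  shows "(radial_ext h has_derivative (\<lambda>u. sphere_grad h y \<bullet> u)) (at y)"
proof -
  have "Ck_on (Suc 0) (- {0}) (radial_ext h)"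
    using sm unfolding smooth_on_sphere_def smooth_on_def by blast
  then have "radial_ext h differentiable at y" using assms by simp
  then have d: "(radial_ext h has_derivative frechet_derivative (radial_ext h) (at y)) (at y)"
    using frechet_derivative_works by blast
  then have lin: "linear (frechet_derivative (radial_ext h) (at y))" by (rule has_derivative_linear)
  have "frechet_derivative (radial_ext h) (at y) u = sphere_grad h y \<bullet> u" for u
  proof -
    have "frechet_derivative (radial_ext h) (at y) u
        = frechet_derivative (radial_ext h) (at y) (\<Sum>b\<in>Basis. (u \<bullet> b) *\<^sub>R b)"
      by (simp add: euclidean_representation)
    also have "\<dots> = (\<Sum>b\<in>Basis. (u \<bullet> b) * frechet_derivative (radial_ext h) (at y) b)"
      using lin by (simp add: linear_sum linear_cmul)
    also have "\<dots> = sphere_grad h y \<bullet> u"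
      by (simp add: sphere_grad_def sphere_deriv_def inner_sum_left inner_commute[of u] mult.commute)
    finally show ?thesis .
  qed
  then have "frechet_derivative (radial_ext h) (at y) = (\<lambda>u. sphere_grad h y \<bullet> u)" by (rule ext)
  with d show ?thesis by simp
qed

lemma sphere_grad_differentiable:
  assumes "y \<noteq> 0" shows "sphere_grad h differentiable at y"
proof -
  have "Ck_on (Suc (Suc 0)) (- {0}) (radial_ext h)"
    using sm unfolding smooth_on_sphere_def smooth_on_def by blast
  then have "(\<lambda>x. frechet_derivative (radial_ext h) (at x) b) differentiable at y" for b
    using assms by simp
  then show ?thesis
    unfolding sphere_grad_def[abs_def] sphere_deriv_def
    by (intro differentiable_sum differentiable_scaleR differentiable_const) auto
qed

text \<open>\<open>sphere_grad h\<close> is the gradient of a 0-homogeneous function, hence of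
  degree -1, and the factor \<open>norm y\<close> makes it constant on rays. This carries
  differentiability over to the radial extension, which is what \<open>sphere_hessian\<close>
  differentiates.\<close>

lemma radial_ext_sphere_grad:
  assumes "y \<noteq> 0" shows "radial_ext (sphere_grad h) y = norm y *\<^sub>R sphere_grad h y"
proof -
  define c where "c = inverse (norm y)"
  have c: "0 < c" using assms by (simp add: c_def)
  have 1: "((\<lambda>z. c *\<^sub>R z) has_derivative (\<lambda>z. c *\<^sub>R z)) (at y)"
    by (auto intro!: derivative_eq_intros)
  have "(radial_ext h has_derivative (\<lambda>u. sphere_grad h (c *\<^sub>R y) \<bullet> u)) (at (c *\<^sub>R y))"
    using assms c by (intro radial_ext_deriv) auto
  from diff_chain_at[OF 1 this]
  have "(radial_ext h has_derivative (\<lambda>u. sphere_grad h (c *\<^sub>R y) \<bullet> (c *\<^sub>R u))) (at y)"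
    using c by (simp add: o_def radial_ext_scale)
  from has_derivative_unique[OF this radial_ext_deriv[OF assms]]
  have "sphere_grad h (c *\<^sub>R y) \<bullet> (c *\<^sub>R u) = sphere_grad h y \<bullet> u" for u by metis
  then have "(c *\<^sub>R sphere_grad h (c *\<^sub>R y) - sphere_grad h y) \<bullet> u = 0" for u
    by (simp add: inner_diff_left)
  then have "c *\<^sub>R sphere_grad h (c *\<^sub>R y) = sphere_grad h y"
    by (metis inner_eq_zero_iff right_minus_eq)
  then have "norm y *\<^sub>R (c *\<^sub>R sphere_grad h (c *\<^sub>R y)) = norm y *\<^sub>R sphere_grad h y" by simp
  then show ?thesis using assms by (simp add: radial_ext_def c_def)
qed

lemma sphere_hom_deriv:
  assumes "y \<noteq> 0" shows "(sphere_hom h has_derivative (\<lambda>u. sphere_hom_grad h y \<bullet> u)) (at y)"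
  unfolding sphere_hom_def[abs_def] sphere_hom_grad_def radial_ext_sphere_grad[OF assms]
  by (rule has_derivative_eq_rhs[OF has_derivative_mult[OF has_derivative_norm[OF assms] radial_ext_deriv[OF assms]]])
     (auto simp: inner_add_left inner_commute[of _ "sgn y"])

lemma radial_grad_differentiable:
  assumes "y \<noteq> 0" shows "radial_ext (sphere_grad h) differentiable at y"
proof -
  have "(\<lambda>y. norm y *\<^sub>R sphere_grad h y) differentiable at y"
    using assms by (intro differentiable_scaleR sphere_grad_differentiable) auto
  then obtain D where "((\<lambda>y. norm y *\<^sub>R sphere_grad h y) has_derivative D) (at y)"
    unfolding differentiable_def by blast
  then have "(radial_ext (sphere_grad h) has_derivative D) (at y)"
    by (rule has_derivative_transform_within_open[where s="- {0}"])
       (use assms in \<open>auto simp: radial_ext_sphere_grad\<close>)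
  then show ?thesis unfolding differentiable_def by blast
qed

lemma sphere_hom_grad_deriv:
  assumes "y \<noteq> 0"
  shows "(sphere_hom_grad h has_derivative
    (\<lambda>u. (radial_ext h y / norm y) *\<^sub>R u + ((sphere_grad h y \<bullet> u) / norm y - radial_ext h y * (sgn y \<bullet> u) / (norm y)\<^sup>2) *\<^sub>R y
      + sphere_deriv (sphere_grad h) y u)) (at y)"
proof -
  have 1: "((\<lambda>z. radial_ext h z / norm z) has_derivative
      (\<lambda>u. (sphere_grad h y \<bullet> u) / norm y - radial_ext h y * (sgn y \<bullet> u) / (norm y)\<^sup>2)) (at y)"
    using assms
    by (auto intro!: derivative_eq_intros radial_ext_deriv has_derivative_norm
        simp: power2_eq_square field_simps inner_commute)
  have "(radial_ext (sphere_grad h) has_derivative sphere_deriv (sphere_grad h) y) (at y)"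
    unfolding sphere_deriv_def
      using radial_grad_differentiable[OF assms] frechet_derivative_works by blast
  then have "((\<lambda>z. (radial_ext h z / norm z) *\<^sub>R z + radial_ext (sphere_grad h) z) has_derivative
    (\<lambda>u. (radial_ext h y / norm y) *\<^sub>R u + ((sphere_grad h y \<bullet> u) / norm y - radial_ext h y * (sgn y \<bullet> u) / (norm y)\<^sup>2) *\<^sub>R y
      + sphere_deriv (sphere_grad h) y u)) (at y)"
    by (intro has_derivative_add has_derivative_scaleR 1 has_derivative_ident)
  moreover have "(\<lambda>z. (radial_ext h z / norm z) *\<^sub>R z + radial_ext (sphere_grad h) z) = sphere_hom_grad h"
    by (rule ext) (simp add: sphere_hom_grad_def sgn_div_norm divide_inverse)
  ultimately show ?thesis by simp
qed

lemma sphere_hom_grad_has_frechet_derivative: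
  assumes "y \<noteq> 0"
  shows "(sphere_hom_grad h has_derivative frechet_derivative (sphere_hom_grad h) (at y)) (at y)"
  using differentiableI[OF sphere_hom_grad_deriv[OF assms]] frechet_derivative_works by blast

text \<open>In the derivative of the gradient all multiples of \<open>x\<close> drop out against the
  tangent vector \<open>v\<close>; what remains is the bilinear form of the equation.\<close>

lemma sphere_hom_grad_hessian:
  assumes x: "norm x = 1" and v: "v \<bullet> x = 0"
  shows "frechet_derivative (sphere_hom_grad h) (at x) u \<bullet> v = h x * (u \<bullet> v) + sphere_hessian h x u v"
proof -
  have "x \<noteq> 0" using x by auto
  from frechet_derivative_eqI[OF sphere_hom_grad_deriv[OF this]]
  show ?thesis using x v
    by (simp add: inner_add_left inner_commute[of x v] radial_ext_unit sphere_hessian_def)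
qed

end

text \<open>Positive definiteness of the matrix in one frame, applied to the coordinates of
  \<open>u\<close> in that frame.\<close>

lemma solution_pos_def:
  fixes h :: "real^('n::finite option) \<Rightarrow> real"
  assumes h: "h \<in> solutions p" and x: "norm x = 1" and u: "u \<bullet> x = 0" "u \<noteq> 0"
  shows "0 < frechet_derivative (sphere_hom_grad h) (at x) u \<bullet> u"
proof -
  have sm: "smooth_on_sphere h" using h by (simp add: solutions_def)
  let ?L = "frechet_derivative (sphere_hom_grad h) (at x)"
  have "x \<noteq> 0" using x by auto
  then have lin: "linear ?L"
    using has_derivative_linear[OF sphere_hom_grad_has_frechet_derivative[OF sm]] by blast
  obtain Q :: "real^('n option)^('n option)" where Q: "orthogonal_matrix Q" "column None Q = x"
    and fr: "orthonormal_frame_at x (\<lambda>i. column (Some i) Q)" using orthonormal_frame_exists[OF x] .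
  define e where "e i = column (Some i) Q" for i
  define A where "A = hessian_matrix h x e + h x *\<^sub>R mat 1"
  have fr': "orthonormal_frame_at x e" using fr by (simp add: e_def[abs_def])
  have "pos_def_matrix A" using h x fr' unfolding A_def solutions_def by simp
  then have pd: "\<xi> \<noteq> 0 \<Longrightarrow> 0 < \<xi> \<bullet> (A *v \<xi>)" for \<xi> unfolding pos_def_matrix_def by blast
  have Aij: "A $ i $ j = ?L (e i) \<bullet> e j" for i j
    using fr' sphere_hom_grad_hessian[OF sm x, of "e j" "e i"]
    by (simp add: A_def hessian_matrix_def orthonormal_frame_at_def mat_def)
  define \<xi> :: "real^'n" where "\<xi> = (\<chi> i. u \<bullet> e i)"
  have ue: "u = (\<Sum>i\<in>UNIV. \<xi> $ i *\<^sub>R e i)"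
    using vector_eq_sum_frame[OF Q u(1)] by (simp add: \<xi>_def e_def)
  then have "\<xi> \<noteq> 0" using u(2) by auto
  then have "0 < \<xi> \<bullet> (A *v \<xi>)" by (rule pd)
  also have "\<xi> \<bullet> (A *v \<xi>) = (\<Sum>i\<in>UNIV. \<Sum>j\<in>UNIV. \<xi> $ i * (\<xi> $ j * (?L (e i) \<bullet> e j)))"
    by (simp add: inner_vec_def[where 'a=real and 'b='n] matrix_vector_mult_def Aij sum_distrib_left mult_ac)
  also have "\<dots> = (\<Sum>i\<in>UNIV. \<xi> $ i *\<^sub>R ?L (e i)) \<bullet> (\<Sum>j\<in>UNIV. \<xi> $ j *\<^sub>R e j)"
    by (simp add: inner_sum_left inner_sum_right sum_distrib_left, subst sum.swap, simp add: mult.left_commute)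
  also have "(\<Sum>i\<in>UNIV. \<xi> $ i *\<^sub>R ?L (e i)) = ?L u"
    by (subst ue) (simp add: linear_sum[OF lin] linear_cmul[OF lin])
  finally show ?thesis unfolding ue[symmetric] .
qed

lemma solution_smooth_support_function:
  fixes h :: "real^('n::finite option) \<Rightarrow> real"
  assumes h: "h \<in> solutions p"
  shows "smooth_support_function (sphere_hom h) (sphere_hom_grad h) (\<lambda>y. frechet_derivative (sphere_hom_grad h) (at y))"
proof
  have sm: "smooth_on_sphere h" using h by (simp add: solutions_def)
  show "sphere_hom h (c *\<^sub>R y) = c * sphere_hom h y" if "0 \<le> c" for c y
    using that by (cases "c = 0") (auto simp: sphere_hom_def radial_ext_scale)
  show "sphere_hom_grad h (c *\<^sub>R y) = sphere_hom_grad h y" if "0 < c" for c y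
    using that by (simp add: sphere_hom_grad_def radial_ext_scale sgn_scaleR)
  show "(sphere_hom h has_derivative (\<lambda>u. sphere_hom_grad h y \<bullet> u)) (at y)" if "y \<noteq> 0" for y
    by (rule sphere_hom_deriv[OF sm that])
  show "(sphere_hom_grad h has_derivative frechet_derivative (sphere_hom_grad h) (at y)) (at y)" if "y \<noteq> 0" for y
    by (rule sphere_hom_grad_has_frechet_derivative[OF sm that])
  show "0 < sphere_hom h y" if "y \<noteq> 0" for y
    using that h by (auto simp: sphere_hom_def radial_ext_def solutions_def)
  show "0 < frechet_derivative (sphere_hom_grad h) (at x) u \<bullet> u" if "norm x = 1" "u \<bullet> x = 0" "u \<noteq> 0" for x u
    by (rule solution_pos_def[OF h that])
qed

text \<open>The substance is \<open>det_G'\<close>: in a frame at \<open>x\<close> the map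
  \<open>L\<close> acts on tangent vectors by the matrix of the equation, and its radial entry is
  \<open>x \<bullet> w\<close>.\<close>

lemma solution_solution_body:
  fixes h :: "real^('n::finite option) \<Rightarrow> real"
  assumes h: "h \<in> solutions p" and p: "p < 0" and m: "0 < m"
    and bounds: "\<And>x. norm x = 1 \<Longrightarrow> m \<le> h x" "\<And>x. norm x = 1 \<Longrightarrow> h x \<le> M"
  shows "solution_body (sphere_hom h) (sphere_hom_grad h) (\<lambda>y. frechet_derivative (sphere_hom_grad h) (at y)) p m M"
proof -
  interpret smooth_support_function "sphere_hom h" "sphere_hom_grad h"
      "\<lambda>y. frechet_derivative (sphere_hom_grad h) (at y)"
    by (rule solution_smooth_support_function[OF h])
  have sm: "smooth_on_sphere h" using h by (simp add: solutions_def)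
  have Hh: "sphere_hom h x = h x" if "norm x = 1" for x
    using that by (simp add: sphere_hom_def radial_ext_unit)
  show ?thesis
  proof
    let ?D = "\<lambda>y. sphere_hom h (sgn y) powr (p - 1)"
    show "bounded_borel ?D"
    proof (rule bounded_borelI[where C="m powr (p - 1)"])
      have "sphere_hom h \<in> borel_measurable borel"
        by (rule borel_measurable_continuous_countable_exceptions[OF _ continuous_on_H]) simp
      then show "?D \<in> borel_measurable borel" by measurable
      show "\<bar>?D y\<bar> \<le> m powr (p - 1)" if "y \<in> punctured_ball" for y
        using that bounds(1)[of "sgn y"] m p by (auto simp: norm_sgn Hh intro: powr_mono2')
    qed
    fix y w :: "real^('n option)" assume y: "y \<noteq> 0"
    define x where "x = sgn y"
    have x: "norm x = 1" and yx: "y = norm y *\<^sub>R x"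
      using y by (simp_all add: x_def norm_sgn sgn_div_norm)
    then have "x \<noteq> 0" by auto
    let ?G' = "\<lambda>y. frechet_derivative (sphere_hom_grad h) (at y)"
    define L where "L u = (x \<bullet> u) *\<^sub>R w + ?G' x u" for u
    \<comment> \<open>\<open>G'\<close> has degree -1, so the claim at \<open>y\<close> is the claim
      at the unit vector \<open>x\<close>.\<close>
    have "norm y *\<^sub>R ?G' y u = ?G' x u" for u
      using G'_scale[OF \<open>x \<noteq> 0\<close>, of "norm y" u] y yx by simp
    then have L: "(\<lambda>u. (sgn y \<bullet> u) *\<^sub>R w + norm y *\<^sub>R ?G' y u) = L"
      by (simp add: L_def[abs_def] x_def)
    have linL: "linear L" unfolding L_def[abs_def]
      by (intro linear_compose_add linear_G' \<open>x \<noteq> 0\<close>) (auto intro!: linearI simp: inner_add_right algebra_simps)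
    obtain Q :: "real^('n option)^('n option)" where Q: "orthogonal_matrix Q" "column None Q = x"
      and fr: "orthonormal_frame_at x (\<lambda>i. column (Some i) Q)"
        using orthonormal_frame_exists[OF x] .
    define e where "e i = column (Some i) Q" for i
    have e: "orthonormal_frame_at x e" using fr by (simp add: e_def[abs_def])
    then have ex: "e i \<bullet> x = 0" "x \<bullet> e i = 0" for i
      by (auto simp: orthonormal_frame_at_def inner_commute)
    have xG: "x \<bullet> ?G' x u = 0" for u using G'_inner_self[OF \<open>x \<noteq> 0\<close>] by (simp add: inner_commute)
    define A where "A = hessian_matrix h x e + h x *\<^sub>R mat 1"
    have detA: "det A = h x powr (p - 1)" using h x e unfolding A_def solutions_def by simp
    \<comment> \<open>Rows and columns come out exchanged, which the determinant does not
      see.\<close>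
    have "e i \<bullet> L (e j) = A $ j $ i" for i j
      using e sphere_hom_grad_hessian[OF sm x ex(1), of "e j" i]
      by (simp add: L_def inner_add_right ex inner_commute[of "e i"] A_def hessian_matrix_def orthonormal_frame_at_def mat_def)
    then have "(\<chi> i j. e i \<bullet> L (e j)) = transpose A" by (simp add: transpose_def)
    moreover have "x \<bullet> L (e j) = 0" for j by (simp add: L_def inner_add_right ex xG)
    moreover have "x \<bullet> L x = x \<bullet> w" using x by (simp add: L_def inner_add_right xG norm_eq_1)
    ultimately have "det (matrix L) = (x \<bullet> w) * det A"
      using det_eq_minor_in_frame[OF linL Q] by (simp add: e_def det_transpose)
    then show "det (matrix (\<lambda>u. (sgn y \<bullet> u) *\<^sub>R w + norm y *\<^sub>R ?G' y u)) = (sgn y \<bullet> w) * ?D y"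
      unfolding L by (simp add: detA Hh x flip: x_def)
  qed (use p m bounds Hh in auto)
qed

text \<open>The witnesses are the attained minimum and maximum of \<open>h\<close>, as
  \<open>ratio_bound\<close> requires.\<close>

lemma solution_bounds:
  fixes h :: "real^('n::finite option) \<Rightarrow> real" and p :: real
  assumes h: "h \<in> solutions p" and p: "p < - real CARD('n) - 1"
  obtains m M where "0 < m" "m \<le> 1" "1 \<le> M" "\<And>x. norm x = 1 \<Longrightarrow> m \<le> h x" "\<And>x. norm x = 1 \<Longrightarrow> h x \<le> M"
    and "(m / M) powr (p + real CARD('n option))
      \<le> 2 * real CARD('n option) * 4 ^ CARD('n option) * (12 * real CARD('n option)) powr (- p)"
proof -
  interpret smooth_support_function "sphere_hom h" "sphere_hom_grad h"
      "\<lambda>y. frechet_derivative (sphere_hom_grad h) (at y)"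
    by (rule solution_smooth_support_function[OF h])
  have Hh: "sphere_hom h x = h x" if "norm x = 1" for x
    using that by (simp add: sphere_hom_def radial_ext_unit)
  have sp: "sphere (0::real^('n option)) 1 \<noteq> {}" by simp
  have "continuous_on (sphere 0 1) (sphere_hom h)"
    by (rule continuous_on_subset[OF continuous_on_H]) auto
  then obtain x0 x1 where x0: "norm x0 = 1" "\<And>x. norm x = 1 \<Longrightarrow> h x \<le> h x0"
    and x1: "norm x1 = 1" "\<And>x. norm x = 1 \<Longrightarrow> h x1 \<le> h x"
    using continuous_attains_sup[OF compact_sphere sp] continuous_attains_inf[OF compact_sphere sp]
    by (metis Hh mem_sphere_0)
  have pos: "0 < h x1" using h x1(1) by (simp add: solutions_def)
  interpret solution_body "sphere_hom h" "sphere_hom_grad h"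
      "\<lambda>y. frechet_derivative (sphere_hom_grad h) (at y)" p "h x1" "h x0"
    by (rule solution_solution_body[OF h _ pos x1(2) x0(2)]) (use p in auto)
  show thesis
    by (rule that[OF pos m_le_1 M_ge_1 x1(2) x0(2)], assumption, assumption)
       (rule ratio_bound[OF x0(1) _ x1(1)], use p in \<open>auto simp: Hh x0(1) x1(1)\<close>)
qed

section \<open>The bound uniform in p\<close>

theorem theorem1p5:
  fixes P :: "real set"
  assumes "CARD('n::finite) \<ge> 2"
    and "compact P" and "P \<subseteq> {..< - real CARD('n) - 1}"
  shows "\<exists>C>0. \<forall>p\<in>P. \<forall>h \<in> (solutions p :: (real ^ ('n option) \<Rightarrow> real) set).
           \<forall>x\<in>sphere 0 1. 1 / C \<le> h x \<and> h x \<le> C"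
proof (cases "P = {}")
  case False
  let ?N = "real CARD('n option)"
  have N: "?N = real CARD('n) + 1" "1 \<le> ?N" by simp_all
  obtain b where b: "b \<in> P" "\<And>p. p \<in> P \<Longrightarrow> p \<le> b"
    using compact_attains_sup[OF assms(2) False] by blast
  obtain a where a: "\<And>p. p \<in> P \<Longrightarrow> a \<le> p" using compact_attains_inf[OF assms(2) False] by blast
  \<comment> \<open>\<open>- (p + ?N)\<close> is at least this for every p in P; it is positive
    because the compact set P attains its maximum.\<close>
  define \<kappa> where "\<kappa> = - (b + ?N)"
  have \<kappa>: "0 < \<kappa>" using b(1) assms(3) N by (auto simp: \<kappa>_def)
  \<comment> \<open>The bound of \<open>ratio_bound\<close> with the lower bound \<open>a\<close> of
    P in place of p; it grows with -p since 12 N \<ge> 1.\<close>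
  define R where "R = 2 * ?N * 4 ^ CARD('n option) * (12 * ?N) powr (- a)"
  have R: "0 < R" using N(2) by (simp add: R_def)
  define C where "C = R powr (1 / \<kappa>)"
  have C: "0 < C" using R by (simp add: C_def)
  show ?thesis
  proof (intro exI[of _ C] conjI C ballI)
    fix p and h :: "real^('n option) \<Rightarrow> real" and x :: "real^('n option)"
    assume p: "p \<in> P" and h: "h \<in> solutions p" and x: "x \<in> sphere 0 1"
    have "p < - real CARD('n) - 1" using p assms(3) by auto
    then obtain m M where m: "0 < m" "m \<le> 1" and M: "1 \<le> M"
      and bd: "\<And>x. norm x = 1 \<Longrightarrow> m \<le> h x" "\<And>x. norm x = 1 \<Longrightarrow> h x \<le> M"
      and ratio: "(m / M) powr (p + ?N) \<le> 2 * ?N * 4 ^ CARD('n option) * (12 * ?N) powr (- p)"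
      using solution_bounds[OF h] by metis
    have "(M / m) powr \<kappa> \<le> (M / m) powr (- (p + ?N))"
      using m M b(2)[OF p] by (intro powr_mono) (auto simp: \<kappa>_def)
    also have "\<dots> = (m / M) powr (p + ?N)"
    proof -
      have "M / m = inverse (m / M)" by simp
      then show ?thesis by (simp only: powr_minus inverse_powr inverse_inverse_eq)
    qed
    also have "\<dots> \<le> 2 * ?N * 4 ^ CARD('n option) * (12 * ?N) powr (- p)" by (rule ratio)
    also have "\<dots> \<le> R"
      unfolding R_def using a[OF p] N(2) by (intro mult_left_mono powr_mono) auto
    finally have "((M / m) powr \<kappa>) powr (1 / \<kappa>) \<le> C"
      unfolding C_def using \<kappa> by (intro powr_mono2) auto
    then have MC: "M / m \<le> C" using \<kappa> m M by (simp add: powr_powr)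
    \<comment> \<open>By m \<le> 1 \<le> M the ratio dominates both M and 1/m, so the bound on M / m
      gives both estimates.\<close>
    have "M \<le> M / m" using m M by (simp add: le_divide_eq mult_left_le)
    moreover have "1 \<le> m * C" using MC m M by (simp add: divide_le_eq mult.commute)
    then have "1 / C \<le> m" using C by (simp add: divide_le_eq)
    ultimately show "1 / C \<le> h x" "h x \<le> C" using MC bd[of x] x by auto
  qed
qed (auto intro: exI[of _ 1])

end
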